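(* Let $\mathbb{K}$ be a field, $R=\mathbb{K}[X_1,\ldots,X_n]$ the standard graded polynomial ring, and $I\subset R$ a homogeneous ideal. Then $\operatorname{pd}(R/I)=\operatorname{pd}(R/I^{[m]})$ for all integers $m\ge 1$, where $\operatorname{pd}$ denotes projective dimension over $R$.
   Context: For $f\in R$ and a positive integer $m$, $f^{[m]}:=f(X_1^m,\ldots,X_n^m)$, and the $m$-th square power of an ideal $I\subset R$ is the ideal $I^{[m]}:=\langle f^{[m]} : f\in I\rangle$ of $R$. *)

theory Defs
  imports
    "HOL-Algebra.QuotRing"
    "HOL-Algebra.Module"
    "HOL-Library.Poly_Mapping"
    "HOL-Library.Extended_Nat"
begin

section \<open>The polynomial ring\<close>

text \<open>
  A power product is a finitely supported map from variable indices to exponents. The ring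
  \<open>K[X\<^sub>1, \<dots>, X\<^sub>n]\<close> consists of the polynomials involving only the indices \<open>1, \<dots>, n\<close>; for
  \<open>n = 0\<close> it is \<open>K\<close>.
\<close>

type_synonym 'k mpoly = "(nat \<Rightarrow>\<^sub>0 nat) \<Rightarrow>\<^sub>0 'k"

definition mpoly_ring :: "nat \<Rightarrow> 'k::field mpoly ring" where
  "mpoly_ring n =
    \<lparr>carrier = {f. \<forall>t\<in>Poly_Mapping.keys f. Poly_Mapping.keys t \<subseteq> {1..n}},
     mult = (*), one = 1, zero = 0, add = (+)\<rparr>"

definition mpoly_const :: "'k::field \<Rightarrow> 'k mpoly" where
  "mpoly_const c = Poly_Mapping.single 0 c"

definition mpoly_var :: "nat \<Rightarrow> 'k::field mpoly" where
  "mpoly_var i = Poly_Mapping.single (Poly_Mapping.single i 1) 1"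

definition mpoly_subst :: "(nat \<Rightarrow> 'k::field mpoly) \<Rightarrow> 'k mpoly \<Rightarrow> 'k mpoly" where
  "mpoly_subst g f =
    (\<Sum>t\<in>Poly_Mapping.keys f.
      mpoly_const (Poly_Mapping.lookup f t) * (\<Prod>i\<in>Poly_Mapping.keys t. g i ^ Poly_Mapping.lookup t i))"

definition total_degree :: "(nat \<Rightarrow>\<^sub>0 nat) \<Rightarrow> nat" where
  "total_degree t = (\<Sum>i\<in>Poly_Mapping.keys t. Poly_Mapping.lookup t i)"

definition homogeneous :: "'k::field mpoly \<Rightarrow> bool" where
  "homogeneous f \<longleftrightarrow> (\<exists>d. \<forall>t\<in>Poly_Mapping.keys f. total_degree t = d)"

definition homogeneous_ideal :: "nat \<Rightarrow> 'k::field mpoly set \<Rightarrow> bool" where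
  "homogeneous_ideal n I \<longleftrightarrow>
    ideal I (mpoly_ring n) \<and>
    (\<exists>S \<subseteq> carrier (mpoly_ring n). (\<forall>f\<in>S. homogeneous f) \<and> I = Idl\<^bsub>mpoly_ring n\<^esub> S)"

definition square_power :: "nat \<Rightarrow> nat \<Rightarrow> 'k::field mpoly set \<Rightarrow> 'k mpoly set" where
  "square_power n m I =
    Idl\<^bsub>mpoly_ring n\<^esub> ((\<lambda>f. mpoly_subst (\<lambda>i. mpoly_var i ^ m) f) ` I)"


section \<open>Projective dimension of modules\<close>

definition quot_module :: "('r, 'x) ring_scheme \<Rightarrow> 'r set \<Rightarrow> ('r, 'r set) module" where
  "quot_module R I =
    ring.extend (R Quot I) \<lparr>smult = (\<lambda>r C. (I +>\<^bsub>R\<^esub> r) \<otimes>\<^bsub>R Quot I\<^esub> C)\<rparr>"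

definition mod_hom ::
  "('r, 'x) ring_scheme \<Rightarrow> ('r, 'a) module \<Rightarrow> ('r, 'b) module \<Rightarrow> ('a \<Rightarrow> 'b) set" where
  "mod_hom R M N =
    {h \<in> carrier M \<rightarrow> carrier N.
      (\<forall>x\<in>carrier M. \<forall>y\<in>carrier M. h (x \<oplus>\<^bsub>M\<^esub> y) = h x \<oplus>\<^bsub>N\<^esub> h y) \<and>
      (\<forall>r\<in>carrier R. \<forall>x\<in>carrier M. h (r \<odot>\<^bsub>M\<^esub> x) = r \<odot>\<^bsub>N\<^esub> h x)}"

text \<open>
  Projectivity and projective resolutions quantify over modules, which in HOL must have their
  carriers in some fixed type. For modules with carrier in \<open>'a\<close> over a ring with carrier in
  \<open>'r\<close> we use the type \<open>('r \<times> 'a) list\<close>. It is infinite and at least as large as both \<open>'r\<close>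
  and \<open>'a\<close>, so, up to isomorphism, it accommodates every module generated by at most
  \<open>|('r \<times> 'a) list|\<close> elements; in particular it accommodates a free module mapping onto any
  module with carrier in \<open>'a\<close> or in \<open>('r \<times> 'a) list\<close>. Hence lifting against
  the test modules below already splits a free cover of \<open>P\<close>, and every such module has a
  projective resolution, of minimal length among all resolutions, with carriers in
  \<open>('r \<times> 'a) list\<close>. So neither notion depends on this choice.
\<close>

definition projective_module :: "('r, 'x) ring_scheme \<Rightarrow> ('r, 'a) module \<Rightarrow> bool" where
  "projective_module R P \<longleftrightarrow>
    Module.module R P \<and>
    (\<forall>(M :: ('r, ('r \<times> 'a) list) module) (N :: ('r, ('r \<times> 'a) list) module) g f.
      Module.module R M \<and> Module.module R N \<and>
      g \<in> mod_hom R M N \<and> g ` carrier M = carrier N \<and> f \<in> mod_hom R P N \<longrightarrow>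
      (\<exists>h \<in> mod_hom R P M. \<forall>x\<in>carrier P. g (h x) = f x))"

text \<open>
  \<open>\<cdots> \<rightarrow> P 1 \<rightarrow> P 0 \<rightarrow> M \<rightarrow> 0\<close> is exact with augmentation \<open>e\<close> and differentials
  \<open>d i : P (i + 1) \<rightarrow> P i\<close>.
\<close>

definition projective_resolution ::
  "('r, 'x) ring_scheme \<Rightarrow> ('r, 'a) module \<Rightarrow> (nat \<Rightarrow> ('r, 'b) module) \<Rightarrow>
    (nat \<Rightarrow> 'b \<Rightarrow> 'b) \<Rightarrow> ('b \<Rightarrow> 'a) \<Rightarrow> bool" where
  "projective_resolution R M P d e \<longleftrightarrow>
    (\<forall>i. projective_module R (P i)) \<and>
    e \<in> mod_hom R (P 0) M \<and> e ` carrier (P 0) = carrier M \<and>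
    (\<forall>i. d i \<in> mod_hom R (P (Suc i)) (P i)) \<and>
    d 0 ` carrier (P 1) = a_kernel (P 0) M e \<and>
    (\<forall>i. d (Suc i) ` carrier (P (Suc (Suc i))) = a_kernel (P (Suc i)) (P i) (d i))"

text \<open>The infimum of the empty set is \<open>\<infinity>\<close>; the zero module gets projective dimension \<open>0\<close>.\<close>

definition projective_dimension :: "('r, 'x) ring_scheme \<Rightarrow> ('r, 'a) module \<Rightarrow> enat" where
  "projective_dimension R M =
    Inf {enat l | l. \<exists>(P :: nat \<Rightarrow> ('r, ('r \<times> 'a) list) module) d e.
      projective_resolution R M P d e \<and> (\<forall>i>l. carrier (P i) = {\<zero>\<^bsub>P i\<^esub>})}"


section \<open>Well-formedness\<close>

lemma cring_mpoly_ring: "cring (mpoly_ring n :: 'k::field mpoly ring)"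
proof (rule cringI)
  show "abelian_group (mpoly_ring n :: 'k mpoly ring)"
  proof (rule abelian_groupI)
    fix x y :: "'k mpoly"
    assume "x \<in> carrier (mpoly_ring n)" "y \<in> carrier (mpoly_ring n)"
    then show "x \<oplus>\<^bsub>mpoly_ring n\<^esub> y \<in> carrier (mpoly_ring n)"
      using Poly_Mapping.keys_add[of x y] by (auto simp: mpoly_ring_def)
  next
    fix x :: "'k mpoly"
    assume "x \<in> carrier (mpoly_ring n)"
    then show "\<exists>y\<in>carrier (mpoly_ring n). y \<oplus>\<^bsub>mpoly_ring n\<^esub> x = \<zero>\<^bsub>mpoly_ring n\<^esub>"
      by (intro bexI[of _ "- x"]) (auto simp: mpoly_ring_def)
  qed (auto simp: mpoly_ring_def algebra_simps)
  show "comm_monoid (mpoly_ring n :: 'k mpoly ring)"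
  proof (rule comm_monoidI)
    fix x y :: "'k mpoly"
    assume x: "x \<in> carrier (mpoly_ring n)" and y: "y \<in> carrier (mpoly_ring n)"
    have "Poly_Mapping.keys t \<subseteq> {1..n}" if "t \<in> Poly_Mapping.keys (x * y)" for t
    proof -
      from that keys_mult[of x y] obtain a b
        where "a \<in> Poly_Mapping.keys x" "b \<in> Poly_Mapping.keys y" "t = a + b"
        by blast
      with x y Poly_Mapping.keys_add[of a b] show ?thesis
        by (fastforce simp: mpoly_ring_def)
    qed
    then show "x \<otimes>\<^bsub>mpoly_ring n\<^esub> y \<in> carrier (mpoly_ring n)"
      by (auto simp: mpoly_ring_def)
  qed (auto simp: mpoly_ring_def algebra_simps)
qed (auto simp: mpoly_ring_def algebra_simps)

lemma module_quot_module:
  assumes "cring R" "ideal I R"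
  shows "Module.module R (quot_module R I)"
proof -
  interpret cring R by fact
  interpret ideal I R by fact
  interpret Q: ring "R Quot I"
    by (rule quotient_is_ring)
  have "abelian_group (quot_module R I)"
    by (rule abelian_groupI)
      (use Q.add.l_inv_ex in \<open>auto simp: quot_module_def ring.defs Q.a_ac\<close>)
  then show ?thesis
    by (intro moduleI)
      (auto simp: assms quot_module_def ring.defs FactRing_simps rcoset_mult_add a_rcos_sum
        l_distr r_distr m_assoc)
qed

lemma mpoly_subst_var: "mpoly_subst g (mpoly_var i) = g i"
  by (simp add: mpoly_subst_def mpoly_var_def mpoly_const_def)

end

theory Submission
  imports Defs "HOL-Library.FuncSet"
begin

text \<open>
  The substitution \<open>X\<^sub>i \<mapsto> X\<^sub>i\<^sup>m\<close> makes \<open>R\<close> a free module over itself, with basis the power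
  products all of whose exponents are less than \<open>m\<close>. Base change along it is exact, preserves
  projectives and turns \<open>R/I\<close> into \<open>R/I\<^sup>[\<^sup>m\<^sup>]\<close>, so the projective dimension does not increase.
  Restriction of scalars along it is also exact and preserves projectives, and \<open>R/I\<close> is a direct
  summand of the restriction of \<open>R/I\<^sup>[\<^sup>m\<^sup>]\<close>; as direct summands do not have larger projective
  dimension, the reverse inequality follows.
\<close>

section \<open>Modules and linear maps\<close>

text \<open>The obstacle is one of carrier types. \<open>projective_dimension\<close> only sees
  resolutions with carriers in \<open>('r \<times> 'a) list\<close>, whereas base change produces
  carriers of functions. So an inequality is never proved by handing a resolution over: a resolution
  of the right length on any type is enough, and a new one is built from free covers inside the
  prescribed list type. What passes from one syzygy to the next is a splitting of the identity
  through the other module's syzygy and some projective module. This needs neither Ext nor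
  Schanuel's lemma, and no direct sum is ever formed. The free extension enters only through its
  coordinate functionals. A tensor product becomes a finite family of elements, so exactness can be
  checked in each coordinate. The power product 1 belongs to the basis, and its coordinate is a
  linear left inverse of the substitution that maps \<open>I^[m]\<close> into \<open>I\<close>; this
  is where the direct summand comes from. The substitution fixes the coefficients, so nothing
  depends on the characteristic.\<close>

lemma module_if_smult_zero:
  fixes R (structure) and M (structure)
  assumes "cring R"
    and "\<zero>\<^bsub>M\<^esub> \<in> carrier M"
    and "\<And>x y. x \<in> carrier M \<Longrightarrow> y \<in> carrier M \<Longrightarrow> x \<oplus>\<^bsub>M\<^esub> y \<in> carrier M"
    and "\<And>x y z. x \<in> carrier M \<Longrightarrow> y \<in> carrier M \<Longrightarrow> z \<in> carrier M \<Longrightarrow>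
      (x \<oplus>\<^bsub>M\<^esub> y) \<oplus>\<^bsub>M\<^esub> z = x \<oplus>\<^bsub>M\<^esub> (y \<oplus>\<^bsub>M\<^esub> z)"
    and "\<And>x y. x \<in> carrier M \<Longrightarrow> y \<in> carrier M \<Longrightarrow> x \<oplus>\<^bsub>M\<^esub> y = y \<oplus>\<^bsub>M\<^esub> x"
    and l_zero: "\<And>x. x \<in> carrier M \<Longrightarrow> \<zero>\<^bsub>M\<^esub> \<oplus>\<^bsub>M\<^esub> x = x"
    and closed: "\<And>a x. a \<in> carrier R \<Longrightarrow> x \<in> carrier M \<Longrightarrow> a \<odot>\<^bsub>M\<^esub> x \<in> carrier M"
    and distr: "\<And>a b x. a \<in> carrier R \<Longrightarrow> b \<in> carrier R \<Longrightarrow> x \<in> carrier M \<Longrightarrow>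
      (a \<oplus> b) \<odot>\<^bsub>M\<^esub> x = (a \<odot>\<^bsub>M\<^esub> x) \<oplus>\<^bsub>M\<^esub> (b \<odot>\<^bsub>M\<^esub> x)"
    and "\<And>a x y. a \<in> carrier R \<Longrightarrow> x \<in> carrier M \<Longrightarrow> y \<in> carrier M \<Longrightarrow>
      a \<odot>\<^bsub>M\<^esub> (x \<oplus>\<^bsub>M\<^esub> y) = (a \<odot>\<^bsub>M\<^esub> x) \<oplus>\<^bsub>M\<^esub> (a \<odot>\<^bsub>M\<^esub> y)"
    and "\<And>a b x. a \<in> carrier R \<Longrightarrow> b \<in> carrier R \<Longrightarrow> x \<in> carrier M \<Longrightarrow>
      (a \<otimes> b) \<odot>\<^bsub>M\<^esub> x = a \<odot>\<^bsub>M\<^esub> (b \<odot>\<^bsub>M\<^esub> x)"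
    and one: "\<And>x. x \<in> carrier M \<Longrightarrow> \<one> \<odot>\<^bsub>M\<^esub> x = x"
    and null: "\<And>x. x \<in> carrier M \<Longrightarrow> \<zero> \<odot>\<^bsub>M\<^esub> x = \<zero>\<^bsub>M\<^esub>"
  shows "Module.module R M"
proof -
  interpret cring R by fact
  \<comment> \<open>Inverses need not be supplied: by \<open>null\<close>, the scalar -1 provides
    them.\<close>
  have "\<exists>y\<in>carrier M. y \<oplus>\<^bsub>M\<^esub> x = \<zero>\<^bsub>M\<^esub>" if "x \<in> carrier M" for x
  proof (intro bexI[of _ "(\<ominus> \<one>) \<odot>\<^bsub>M\<^esub> x"])
    show "(\<ominus> \<one>) \<odot>\<^bsub>M\<^esub> x \<oplus>\<^bsub>M\<^esub> x = \<zero>\<^bsub>M\<^esub>"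
      using that distr[of "\<ominus> \<one>" \<one> x] one null by (simp add: l_neg)
  qed (use that closed in simp)
  with assms show ?thesis
    by (intro moduleI abelian_groupI) auto
qed

lemma mod_homI:
  assumes "\<And>x. x \<in> carrier M \<Longrightarrow> h x \<in> carrier N"
    and "\<And>x y. x \<in> carrier M \<Longrightarrow> y \<in> carrier M \<Longrightarrow> h (x \<oplus>\<^bsub>M\<^esub> y) = h x \<oplus>\<^bsub>N\<^esub> h y"
    and "\<And>r x. r \<in> carrier R \<Longrightarrow> x \<in> carrier M \<Longrightarrow> h (r \<odot>\<^bsub>M\<^esub> x) = r \<odot>\<^bsub>N\<^esub> h x"
  shows "h \<in> mod_hom R M N"
  using assms by (auto simp: mod_hom_def)

lemma
  assumes "h \<in> mod_hom R M N"
  shows mod_hom_closed: "x \<in> carrier M \<Longrightarrow> h x \<in> carrier N"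
    and mod_hom_add:
      "x \<in> carrier M \<Longrightarrow> y \<in> carrier M \<Longrightarrow> h (x \<oplus>\<^bsub>M\<^esub> y) = h x \<oplus>\<^bsub>N\<^esub> h y"
    and mod_hom_smult:
      "r \<in> carrier R \<Longrightarrow> x \<in> carrier M \<Longrightarrow> h (r \<odot>\<^bsub>M\<^esub> x) = r \<odot>\<^bsub>N\<^esub> h x"
  using assms by (auto simp: mod_hom_def)

lemma mod_hom_zero:
  assumes "Module.module R M" "Module.module R N" "h \<in> mod_hom R M N"
  shows "h \<zero>\<^bsub>M\<^esub> = \<zero>\<^bsub>N\<^esub>"
proof -
  interpret M: Module.module R M by fact
  interpret N: Module.module R N by fact
  have "h (\<zero>\<^bsub>R\<^esub> \<odot>\<^bsub>M\<^esub> \<zero>\<^bsub>M\<^esub>) = \<zero>\<^bsub>R\<^esub> \<odot>\<^bsub>N\<^esub> h \<zero>\<^bsub>M\<^esub>"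
    using assms(3) by (intro mod_hom_smult) auto
  then show ?thesis
    using mod_hom_closed[OF assms(3)] by simp
qed

lemma mod_hom_comp:
  assumes "g \<in> mod_hom R M N" "h \<in> mod_hom R N P"
  shows "(\<lambda>x. h (g x)) \<in> mod_hom R M P"
  using assms by (auto simp: mod_hom_def Pi_iff)

lemma mod_hom_plus:
  assumes "Module.module R N" "g \<in> mod_hom R M N" "h \<in> mod_hom R M N"
  shows "(\<lambda>x. g x \<oplus>\<^bsub>N\<^esub> h x) \<in> mod_hom R M N"
proof -
  interpret Module.module R N by fact
  show ?thesis
    using assms(2,3) by (intro mod_homI) (auto simp: mod_hom_def Pi_iff M.a_ac smult_r_distr)
qed

lemma mod_hom_diff:
  assumes "Module.module R N" "g \<in> mod_hom R M N" "h \<in> mod_hom R M N"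
  shows "(\<lambda>x. g x \<ominus>\<^bsub>N\<^esub> h x) \<in> mod_hom R M N"
proof -
  interpret Module.module R N by fact
  show ?thesis
    using assms(2,3)
    by (intro mod_homI)
      (auto simp: mod_hom_def Pi_iff a_minus_def M.a_ac M.minus_add smult_r_distr smult_r_minus)
qed

lemma mod_hom_finsum:
  assumes "Module.module R M" "Module.module R N" "h \<in> mod_hom R M N" "f \<in> A \<rightarrow> carrier M"
  shows "h (finsum M f A) = finsum N (\<lambda>a. h (f a)) A"
proof -
  interpret M: Module.module R M by fact
  interpret N: Module.module R N by fact
  show ?thesis
    using assms(4)
  proof (induction A rule: infinite_finite_induct)
    case (insert a A)
    then have "f \<in> A \<rightarrow> carrier M" "f a \<in> carrier M"
      by auto
    with insert show ?case
      using mod_hom_closed[OF assms(3)]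
      by (simp add: M.finsum_insert N.finsum_insert Pi_iff mod_hom_add[OF assms(3)])
  qed (simp_all add: mod_hom_zero[OF assms(1-3)] M.finsum_infinite N.finsum_infinite)
qed

lemma mod_hom_inverse:
  assumes "Module.module R M" "h \<in> mod_hom R M N"
    and "\<And>y. y \<in> carrier N \<Longrightarrow> g y \<in> carrier M"
    and "\<And>y. y \<in> carrier N \<Longrightarrow> h (g y) = y"
    and "\<And>x. x \<in> carrier M \<Longrightarrow> g (h x) = x"
  shows "g \<in> mod_hom R N M"
proof (rule mod_homI)
  interpret Module.module R M by fact
  fix y y' assume "y \<in> carrier N" "y' \<in> carrier N"
  then show "g (y \<oplus>\<^bsub>N\<^esub> y') = g y \<oplus>\<^bsub>M\<^esub> g y'"
    using assms(3-5) mod_hom_add[OF assms(2), of "g y" "g y'"]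
    by (metis M.a_closed)
next
  interpret Module.module R M by fact
  fix r y assume "r \<in> carrier R" "y \<in> carrier N"
  then show "g (r \<odot>\<^bsub>N\<^esub> y) = r \<odot>\<^bsub>M\<^esub> g y"
    using assms(3-5) mod_hom_smult[OF assms(2), of r "g y"]
    by (metis smult_closed)
qed (use assms in simp)

section \<open>Kernels as modules\<close>

lemma a_kernel_eq: "a_kernel M N h = {x \<in> carrier M. h x = \<zero>\<^bsub>N\<^esub>}"
  by (simp add: a_kernel_def kernel_def)

definition ker_module ::
  "('r, 'a) module \<Rightarrow> ('r, 'b) module \<Rightarrow> ('a \<Rightarrow> 'b) \<Rightarrow> ('r, 'a) module" where
  "ker_module M N h = M\<lparr>carrier := a_kernel M N h\<rparr>"

lemma ker_module_simps [simp]: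
  "carrier (ker_module M N h) = a_kernel M N h"
  "\<zero>\<^bsub>ker_module M N h\<^esub> = \<zero>\<^bsub>M\<^esub>"
  "x \<oplus>\<^bsub>ker_module M N h\<^esub> y = x \<oplus>\<^bsub>M\<^esub> y"
  "r \<odot>\<^bsub>ker_module M N h\<^esub> x = r \<odot>\<^bsub>M\<^esub> x"
  by (simp_all add: ker_module_def)

lemma module_ker_module:
  assumes "Module.module R M" "Module.module R N" "h \<in> mod_hom R M N"
  shows "Module.module R (ker_module M N h)"
proof -
  interpret M: Module.module R M by fact
  interpret N: Module.module R N by fact
  show ?thesis
    using mod_hom_zero[OF assms] mod_hom_add[OF assms(3)] mod_hom_smult[OF assms(3)]
    by (intro module_if_smult_zero)
      (auto simp: a_kernel_eq M.a_ac M.smult_l_distr M.smult_r_distr M.smult_assoc1 M.is_cring)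
qed

lemma mod_hom_into_ker_module:
  assumes "g \<in> mod_hom R L M" "\<And>x. x \<in> carrier L \<Longrightarrow> h (g x) = \<zero>\<^bsub>N\<^esub>"
  shows "g \<in> mod_hom R L (ker_module M N h)"
  using assms by (auto simp: mod_hom_def a_kernel_eq Pi_iff)

lemma mod_hom_from_ker_module:
  assumes "g \<in> mod_hom R M L"
  shows "g \<in> mod_hom R (ker_module M N h) L"
  using assms by (auto simp: mod_hom_def a_kernel_eq Pi_iff)

text \<open>Expresses being a direct summand, up to isomorphism, without naming a complement. The
  two carrier types may differ, so the relation also compares modules across types.\<close>

definition retract_of ::
  "('r, 'x) ring_scheme \<Rightarrow> ('r, 'a) module \<Rightarrow> ('r, 'b) module \<Rightarrow> bool" where
  "retract_of R M N \<longleftrightarrow>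
    (\<exists>i \<in> mod_hom R M N. \<exists>p \<in> mod_hom R N M. \<forall>x\<in>carrier M. p (i x) = x)"

lemma retract_ofI:
  assumes "i \<in> mod_hom R M N" "p \<in> mod_hom R N M" "\<And>x. x \<in> carrier M \<Longrightarrow> p (i x) = x"
  shows "retract_of R M N"
  using assms by (auto simp: retract_of_def)

lemma retract_of_trans:
  assumes "retract_of R M N" "retract_of R N P"
  shows "retract_of R M P"
proof -
  from assms obtain i p j q where
    i: "i \<in> mod_hom R M N" and p: "p \<in> mod_hom R N M" and pi: "\<forall>x\<in>carrier M. p (i x) = x" and
    j: "j \<in> mod_hom R N P" and q: "q \<in> mod_hom R P N" and qj: "\<forall>x\<in>carrier N. q (j x) = x"
    unfolding retract_of_def by blast
  then show ?thesis
    by (intro retract_ofI[OF mod_hom_comp[OF i j] mod_hom_comp[OF q p]])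
      (auto simp: mod_hom_closed)
qed

text \<open>An isomorphism is a retraction in both directions; this is the form in which
  isomorphisms are used to pass on projectivity and bounds on resolutions.\<close>

lemma retract_of_if_bij:
  assumes "Module.module R M" "h \<in> mod_hom R M N" "bij_betw h (carrier M) (carrier N)"
  shows "retract_of R M N" "retract_of R N M"
proof -
  let ?g = "inv_into (carrier M) h"
  have "inj_on h (carrier M)" and im: "h ` carrier M = carrier N"
    using assms(3) by (auto simp: bij_betw_def)
  then have g: "?g \<in> mod_hom R N M"
    by (intro mod_hom_inverse[OF assms(1,2)]) (auto simp: inv_into_into f_inv_into_f)
  show "retract_of R M N"
    using assms(2) g \<open>inj_on h (carrier M)\<close> by (intro retract_ofI[of h _ _ _ ?g]) simp_all
  show "retract_of R N M"
    using assms(2) g im by (intro retract_ofI[of ?g _ _ _ h]) (auto simp: f_inv_into_f)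
qed


section \<open>Transport of structure\<close>

text \<open>Moves a module to another carrier type along an injection, because both the test modules
  for projectivity and the terms of a resolution have a prescribed type.\<close>

definition transport :: "('a \<Rightarrow> 'b) \<Rightarrow> ('r, 'a) module \<Rightarrow> ('r, 'b) module" where
  "transport j M =
    (let k = inv_into (carrier M) j in
      \<lparr>carrier = j ` carrier M, mult = (\<lambda>_ _. j \<zero>\<^bsub>M\<^esub>), one = j \<zero>\<^bsub>M\<^esub>, zero = j \<zero>\<^bsub>M\<^esub>,
       add = (\<lambda>x y. j (k x \<oplus>\<^bsub>M\<^esub> k y)), smult = (\<lambda>r x. j (r \<odot>\<^bsub>M\<^esub> k x))\<rparr>)"

lemma carrier_transport [simp]: "carrier (transport j M) = j ` carrier M"
  and zero_transport [simp]: "\<zero>\<^bsub>transport j M\<^esub> = j \<zero>\<^bsub>M\<^esub>"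
  by (simp_all add: transport_def Let_def)

lemma
  assumes "inj_on j (carrier M)" "x \<in> carrier M"
  shows add_transport: "y \<in> carrier M \<Longrightarrow> j x \<oplus>\<^bsub>transport j M\<^esub> j y = j (x \<oplus>\<^bsub>M\<^esub> y)"
    and smult_transport: "r \<odot>\<^bsub>transport j M\<^esub> j x = j (r \<odot>\<^bsub>M\<^esub> x)"
  using assms by (simp_all add: transport_def Let_def)

lemma module_transport:
  assumes "Module.module R M" "inj_on j (carrier M)"
  shows "Module.module R (transport j M)"
proof -
  interpret Module.module R M by fact
  show ?thesis
    by (intro module_if_smult_zero)
      (auto simp: add_transport[OF assms(2)] smult_transport[OF assms(2)] M.a_ac
        smult_l_distr smult_r_distr smult_assoc1 is_cring)
qed

lemma transport_hom:
  assumes "Module.module R M" "inj_on j (carrier M)"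
  shows "j \<in> mod_hom R M (transport j M)"
  by (intro mod_homI) (auto simp: add_transport[OF assms(2)] smult_transport[OF assms(2)])

lemma transport_inv_hom:
  assumes "Module.module R M" "inj_on j (carrier M)"
  shows "inv_into (carrier M) j \<in> mod_hom R (transport j M) M"
  by (rule mod_hom_inverse[OF assms(1) transport_hom[OF assms]])
    (use assms in \<open>auto simp: inv_into_into f_inv_into_f\<close>)

lemma transport_retract_of:
  assumes "Module.module R M" "inj_on j (carrier M)"
  shows "retract_of R (transport j M) M"
  by (rule retract_of_if_bij(2)[OF assms(1) transport_hom[OF assms]])
    (use assms(2) in \<open>simp add: bij_betw_def\<close>)


section \<open>Free and projective modules\<close>

text \<open>The basis is indexed by the whole type \<open>'s\<close>, not by a set. Modules that are
  free on a smaller set therefore appear later as retracts of some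
  \<open>free_module\<close>.\<close>

definition free_module :: "('r, 'x) ring_scheme \<Rightarrow> ('r, 's \<Rightarrow> 'r) module" where
  "free_module R =
    \<lparr>carrier = {f. (\<forall>s. f s \<in> carrier R) \<and> finite {s. f s \<noteq> \<zero>\<^bsub>R\<^esub>}},
     mult = (\<lambda>_ _. (\<lambda>_. \<zero>\<^bsub>R\<^esub>)), one = (\<lambda>_. \<zero>\<^bsub>R\<^esub>), zero = (\<lambda>_. \<zero>\<^bsub>R\<^esub>),
     add = (\<lambda>f g s. f s \<oplus>\<^bsub>R\<^esub> g s), smult = (\<lambda>r f s. r \<otimes>\<^bsub>R\<^esub> f s)\<rparr>"

lemma free_module_simps [simp]:
  "f \<in> carrier (free_module R) \<longleftrightarrow> (\<forall>s. f s \<in> carrier R) \<and> finite {s. f s \<noteq> \<zero>\<^bsub>R\<^esub>}"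
  "\<zero>\<^bsub>free_module R\<^esub> = (\<lambda>_. \<zero>\<^bsub>R\<^esub>)"
  "f \<oplus>\<^bsub>free_module R\<^esub> g = (\<lambda>s. f s \<oplus>\<^bsub>R\<^esub> g s)"
  "r \<odot>\<^bsub>free_module R\<^esub> f = (\<lambda>s. r \<otimes>\<^bsub>R\<^esub> f s)"
  by (simp_all add: free_module_def)

lemma module_free_module:
  assumes "cring R"
  shows "Module.module R (free_module R)"
proof -
  interpret cring R by fact
  have add: "finite {s. f s \<oplus>\<^bsub>R\<^esub> g s \<noteq> \<zero>\<^bsub>R\<^esub>}"
    if "finite {s. f s \<noteq> \<zero>\<^bsub>R\<^esub>}" "finite {s. g s \<noteq> \<zero>\<^bsub>R\<^esub>}" for f g :: "'s \<Rightarrow> _"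
    by (rule finite_subset[of _ "{s. f s \<noteq> \<zero>\<^bsub>R\<^esub>} \<union> {s. g s \<noteq> \<zero>\<^bsub>R\<^esub>}"]) (use that in auto)
  have smult: "finite {s. r \<otimes>\<^bsub>R\<^esub> f s \<noteq> \<zero>\<^bsub>R\<^esub>}"
    if "finite {s. f s \<noteq> \<zero>\<^bsub>R\<^esub>}" "r \<in> carrier R" for r and f :: "'s \<Rightarrow> _"
    by (rule finite_subset[of _ "{s. f s \<noteq> \<zero>\<^bsub>R\<^esub>}"]) (use that in auto)
  show ?thesis
    by (intro module_if_smult_zero)
      (auto simp: assms a_ac l_distr r_distr m_assoc add smult)
qed

text \<open>The scalar action on the base change of a free module is a sum of functions, which has
  to be compared entry by entry.\<close>

lemma eval_free_module_finsum:
  assumes "cring R" "f \<in> A \<rightarrow> carrier (free_module R)"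
  shows "finsum (free_module R) f A s = finsum R (\<lambda>a. f a s) A"
proof -
  interpret cring R by fact
  interpret F: Module.module R "free_module R" by (rule module_free_module) fact
  show ?thesis
    using assms(2)
  proof (induction A rule: infinite_finite_induct)
    case (insert a A)
    then have "f \<in> A \<rightarrow> carrier (free_module R)" "f a \<in> carrier (free_module R)"
      by auto
    with insert show ?case
      by (subst F.finsum_insert) (auto simp: Pi_iff)
  qed (simp_all add: finsum_infinite F.finsum_infinite)
qed

definition free_gen :: "('r, 'x) ring_scheme \<Rightarrow> 's \<Rightarrow> 's \<Rightarrow> 'r" where
  "free_gen R s = (\<lambda>t. if t = s then \<one>\<^bsub>R\<^esub> else \<zero>\<^bsub>R\<^esub>)"

lemma free_gen_closed [simp]:
  assumes "cring R"
  shows "free_gen R s \<in> carrier (free_module R)"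
proof -
  interpret cring R by fact
  show ?thesis
    by (auto simp: free_gen_def)
qed

lemma free_module_lift:
  fixes m :: "'s \<Rightarrow> 'a"
  assumes "Module.module R M" "\<And>s. m s \<in> carrier M"
  obtains h where "h \<in> mod_hom R (free_module R) M" "\<And>s. h (free_gen R s) = m s"
proof -
  interpret Module.module R M by fact
  define h where "h f = (\<Oplus>\<^bsub>M\<^esub>s\<in>{s. f s \<noteq> \<zero>\<^bsub>R\<^esub>}. f s \<odot>\<^bsub>M\<^esub> m s)" for f :: "'s \<Rightarrow> _"
  \<comment> \<open>Any finite set that contains the support may serve as index set; this gives two
    functions and their sum a common one.\<close>
  have h_eq: "h f = (\<Oplus>\<^bsub>M\<^esub>s\<in>B. f s \<odot>\<^bsub>M\<^esub> m s)"
    if "finite B" "{s. f s \<noteq> \<zero>\<^bsub>R\<^esub>} \<subseteq> B" "\<And>s. f s \<in> carrier R" for f B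
    unfolding h_def
    by (rule M.add.finprod_mono_neutral_cong_left) (use that assms(2) in auto)
  have "h \<in> mod_hom R (free_module R) M"
  proof (rule mod_homI)
    fix f :: "'s \<Rightarrow> _" assume "f \<in> carrier (free_module R)"
    with assms(2) show "h f \<in> carrier M"
      unfolding h_def by (intro M.finsum_closed) auto
  next
    fix f g :: "'s \<Rightarrow> _"
    assume f: "f \<in> carrier (free_module R)" and g: "g \<in> carrier (free_module R)"
    let ?B = "{s. f s \<noteq> \<zero>\<^bsub>R\<^esub>} \<union> {s. g s \<noteq> \<zero>\<^bsub>R\<^esub>}"
    have "finite ?B"
      using f g by simp
    then have "h (f \<oplus>\<^bsub>free_module R\<^esub> g) = (\<Oplus>\<^bsub>M\<^esub>s\<in>?B. (f s \<oplus>\<^bsub>R\<^esub> g s) \<odot>\<^bsub>M\<^esub> m s)"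
      using f g by (subst h_eq[of ?B]) auto
    also have "\<dots> = (\<Oplus>\<^bsub>M\<^esub>s\<in>?B. f s \<odot>\<^bsub>M\<^esub> m s \<oplus>\<^bsub>M\<^esub> g s \<odot>\<^bsub>M\<^esub> m s)"
      using f g assms(2) by (intro M.finsum_cong') (auto simp: smult_l_distr)
    also have "\<dots> = (\<Oplus>\<^bsub>M\<^esub>s\<in>?B. f s \<odot>\<^bsub>M\<^esub> m s) \<oplus>\<^bsub>M\<^esub> (\<Oplus>\<^bsub>M\<^esub>s\<in>?B. g s \<odot>\<^bsub>M\<^esub> m s)"
      using f g assms(2) by (intro M.finsum_addf) auto
    also have "\<dots> = h f \<oplus>\<^bsub>M\<^esub> h g"
      using f g \<open>finite ?B\<close> by (subst (1 2) h_eq[of ?B]) auto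
    finally show "h (f \<oplus>\<^bsub>free_module R\<^esub> g) = h f \<oplus>\<^bsub>M\<^esub> h g" .
  next
    fix r and f :: "'s \<Rightarrow> _"
    assume r: "r \<in> carrier R" and f: "f \<in> carrier (free_module R)"
    let ?B = "{s. f s \<noteq> \<zero>\<^bsub>R\<^esub>}"
    have "h (r \<odot>\<^bsub>free_module R\<^esub> f) = (\<Oplus>\<^bsub>M\<^esub>s\<in>?B. (r \<otimes>\<^bsub>R\<^esub> f s) \<odot>\<^bsub>M\<^esub> m s)"
      using f r by (subst h_eq[of ?B]) auto
    also have "\<dots> = (\<Oplus>\<^bsub>M\<^esub>s\<in>?B. r \<odot>\<^bsub>M\<^esub> (f s \<odot>\<^bsub>M\<^esub> m s))"
      using f r assms(2) by (intro M.finsum_cong') (auto simp: smult_assoc1)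
    also have "\<dots> = r \<odot>\<^bsub>M\<^esub> h f"
      unfolding h_def using f r assms(2) by (subst finsum_smult_ldistr) auto
    finally show "h (r \<odot>\<^bsub>free_module R\<^esub> f) = r \<odot>\<^bsub>M\<^esub> h f" .
  qed
  moreover have "h (free_gen R s) = m s" for s
    using assms(2) by (subst h_eq[of "{s}"]) (auto simp: free_gen_def)
  ultimately show thesis
    using that by blast
qed

lemma mod_hom_free_module_eqI:
  assumes "Module.module R M" "g \<in> mod_hom R (free_module R) M" "h \<in> mod_hom R (free_module R) M"
    and gen: "\<And>s. g (free_gen R s) = h (free_gen R s)"
    and f: "f \<in> carrier (free_module R)"
  shows "g f = h f"
proof -
  interpret Module.module R M by fact
  interpret F: Module.module R "free_module R" by (rule module_free_module) (rule is_cring)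
  \<comment> \<open>The induction runs over a finite bound \<open>B\<close> of the support, so that
    resetting the entry at \<open>s\<close> to zero leads from \<open>insert s B\<close> to
    \<open>B\<close>. The removed entry is a multiple of the generator at \<open>s\<close>.\<close>
  have "finite B \<Longrightarrow> \<forall>f. (\<forall>s. f s \<in> carrier R) \<longrightarrow> {s. f s \<noteq> \<zero>\<^bsub>R\<^esub>} \<subseteq> B \<longrightarrow> g f = h f" for B
  proof (induction B rule: finite_induct)
    case empty
    have "f = \<zero>\<^bsub>free_module R\<^esub>" if "{s. f s \<noteq> \<zero>\<^bsub>R\<^esub>} \<subseteq> {}" for f
      using that by auto
    moreover have "g \<zero>\<^bsub>free_module R\<^esub> = h \<zero>\<^bsub>free_module R\<^esub>"
      using assms(2,3)[THEN mod_hom_zero[OF F.module_axioms module_axioms]] by simp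
    ultimately show ?case
      by metis
  next
    case (insert s B)
    show ?case
    proof (intro allI impI)
      fix f assume f: "\<forall>s. f s \<in> carrier R" "{s. f s \<noteq> \<zero>\<^bsub>R\<^esub>} \<subseteq> insert s B"
      let ?f = "f(s := \<zero>\<^bsub>R\<^esub>)"
      have B: "{s. ?f s \<noteq> \<zero>\<^bsub>R\<^esub>} \<subseteq> B"
        using f insert(2) by auto
      have fin: "?f \<in> carrier (free_module R)"
        using finite_subset[OF B insert(1)] f by simp
      have gs: "free_gen R s \<in> carrier (free_module R)"
        by (rule free_gen_closed[OF is_cring])
      have "f = f s \<odot>\<^bsub>free_module R\<^esub> free_gen R s \<oplus>\<^bsub>free_module R\<^esub> ?f"
        using f by (auto simp: fun_eq_iff free_gen_def)
      moreover have "k (f s \<odot>\<^bsub>free_module R\<^esub> free_gen R s \<oplus>\<^bsub>free_module R\<^esub> ?f) =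
          f s \<odot>\<^bsub>M\<^esub> k (free_gen R s) \<oplus>\<^bsub>M\<^esub> k ?f" if "k \<in> mod_hom R (free_module R) M" for k
        using mod_hom_add[OF that F.smult_closed[OF _ gs] fin, of "f s"]
          mod_hom_smult[OF that _ gs, of "f s"] f(1) by (simp del: free_module_simps)
      moreover have "g ?f = h ?f"
        using insert.IH[rule_format, of ?f] B f(1) by (simp add: fun_upd_def)
      ultimately show "g f = h f"
        using gen[of s] assms(2,3) by (metis (no_types))
    qed
  qed
  with f show ?thesis
    by auto
qed

lemma lift_from_free_module:
  fixes f :: "('s \<Rightarrow> 'r) \<Rightarrow> 'b"
  assumes "Module.module R M" "Module.module R N" "g \<in> mod_hom R M N" "g ` carrier M = carrier N"
    and "f \<in> mod_hom R (free_module R) N"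
  shows "\<exists>h\<in>mod_hom R (free_module R) M. \<forall>x\<in>carrier (free_module R). g (h x) = f x"
proof -
  interpret Module.module R M by fact
  have "\<exists>y\<in>carrier M. g y = f (free_gen R s)" for s
    using mod_hom_closed[OF assms(5) free_gen_closed[OF is_cring]] assms(4) by (metis imageE)
  then obtain m where m: "\<And>s. m s \<in> carrier M" "\<And>s. g (m s) = f (free_gen R s)"
    by metis
  obtain h where h: "h \<in> mod_hom R (free_module R) M" "\<And>s. h (free_gen R s) = m s"
    using free_module_lift[OF assms(1), of m] m(1) by metis
  have "g (h x) = f x" if "x \<in> carrier (free_module R)" for x
    by (rule mod_hom_free_module_eqI[OF assms(2) mod_hom_comp[OF h(1) assms(3)] assms(5) _ that])
      (simp add: h m)
  with h(1) show ?thesis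
    by blast
qed

text \<open>Lift \<open>f \<circ> p\<close> on the free module and precompose with \<open>i\<close>.
  The carriers of \<open>M\<close> and \<open>N\<close> may have any type here, unlike in the
  definition of \<open>projective_module\<close>.\<close>

lemma lift_from_retract_of_free_module:
  assumes "retract_of R P (free_module R :: ('r, 's \<Rightarrow> 'r) module)"
    and "Module.module R M" "Module.module R N" "g \<in> mod_hom R M N" "g ` carrier M = carrier N"
    and "f \<in> mod_hom R P N"
  shows "\<exists>h\<in>mod_hom R P M. \<forall>x\<in>carrier P. g (h x) = f x"
proof -
  obtain i p where i: "i \<in> mod_hom R P (free_module R :: ('r, 's \<Rightarrow> 'r) module)"
    and p: "p \<in> mod_hom R (free_module R) P" and pi: "\<forall>x\<in>carrier P. p (i x) = x"
    using assms(1) unfolding retract_of_def by blast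
  obtain h where h: "h \<in> mod_hom R (free_module R) M"
    "\<forall>x\<in>carrier (free_module R). g (h x) = f (p x)"
    using lift_from_free_module[OF assms(2-5) mod_hom_comp[OF p assms(6)]] by blast
  have "\<forall>x\<in>carrier P. g (h (i x)) = f x"
    using h(2) pi mod_hom_closed[OF i] by (simp del: free_module_simps)
  with mod_hom_comp[OF i h(1)] show ?thesis
    by (intro bexI[of _ "\<lambda>x. h (i x)"])
qed

section \<open>Projective modules as retracts of free modules\<close>

lemma projective_module_if_retract_of_free_module:
  assumes "Module.module R P" "retract_of R P (free_module R :: ('r, 's \<Rightarrow> 'r) module)"
  shows "projective_module R P"
  unfolding projective_module_def
proof (intro conjI allI impI, goal_cases)
  case (2 M N g f)
  then show ?case
    by (intro lift_from_retract_of_free_module[OF assms(2), of M N g f]) simp_all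
qed (fact assms(1))

text \<open>One generator is taken for each element of the type \<open>'a\<close>; those outside the
  carrier are sent to zero.\<close>

lemma free_module_cover:
  fixes M :: "('r, 'a) module"
  assumes "Module.module R M"
  obtains e where "e \<in> mod_hom R (free_module R :: ('r, 'a \<Rightarrow> 'r) module) M"
    "e ` carrier (free_module R) = carrier M"
proof -
  interpret Module.module R M by fact
  have closed: "(if s \<in> carrier M then s else \<zero>\<^bsub>M\<^esub>) \<in> carrier M" for s
    by simp
  obtain e where e: "e \<in> mod_hom R (free_module R :: ('r, 'a \<Rightarrow> 'r) module) M"
    "\<And>s. e (free_gen R s) = (if s \<in> carrier M then s else \<zero>\<^bsub>M\<^esub>)"
    using free_module_lift[OF assms, of "\<lambda>s. if s \<in> carrier M then s else \<zero>\<^bsub>M\<^esub>"] closed by metis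
  have "x \<in> e ` carrier (free_module R)" if "x \<in> carrier M" for x
    using e(2)[of x] that free_gen_closed[OF is_cring, of x] by (metis imageI)
  with e(1) that show thesis
    using mod_hom_closed[OF e(1)] by blast
qed

text \<open>A function of finite support is determined by its graph over the support, and a list can
  enumerate that finite set. The value comes first in each pair so that the code lies in the list
  type chosen in the definitions.\<close>

lemma finite_support_encoding:
  "\<exists>k :: ('s \<Rightarrow> 'r) \<Rightarrow> ('r \<times> 's) list. inj_on k {f. finite {s. f s \<noteq> z}}"
proof -
  define k where "k f = (SOME xs. set xs = (\<lambda>s. (f s, s)) ` {s. f s \<noteq> z})" for f :: "'s \<Rightarrow> 'r"
  have set_k: "set (k f) = (\<lambda>s. (f s, s)) ` {s. f s \<noteq> z}" if "finite {s. f s \<noteq> z}" for f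
    unfolding k_def by (rule someI_ex) (use that finite_list in blast)
  have "f = g" if f: "finite {s. f s \<noteq> z}" and g: "finite {s. g s \<noteq> z}" and eq: "k f = k g" for f g
  proof
    fix s
    \<comment> \<open>The order of the enumeration is arbitrary, so only the underlying sets are
      compared.\<close>
    have "set (k f) = set (k g)"
      by (simp only: eq)
    then have "(t, s) \<in> (\<lambda>s. (f s, s)) ` {s. f s \<noteq> z} \<longleftrightarrow>
        (t, s) \<in> (\<lambda>s. (g s, s)) ` {s. g s \<noteq> z}" for t
      by (simp only: set_k[OF f] set_k[OF g])
    then have "f s \<noteq> z \<and> t = f s \<longleftrightarrow> g s \<noteq> z \<and> t = g s" for t
      by (simp add: image_iff)
    then show "f s = g s"
      by metis
  qed
  then have "inj_on k {f. finite {s. f s \<noteq> z}}"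
    by (intro inj_onI) simp
  then show ?thesis
    by (rule exI[of _ k])
qed

text \<open>
  The test modules of \<^const>\<open>projective_module\<close> are large enough to contain a copy of the free
  cover of \<open>P\<close>, which lifting the identity of \<open>P\<close> splits.
\<close>

lemma retract_of_free_module_if_projective_module:
  fixes P :: "('r, 'a) module"
  assumes "projective_module R P"
  shows "retract_of R P (free_module R :: ('r, 'a \<Rightarrow> 'r) module)"
proof -
  let ?F = "free_module R :: ('r, 'a \<Rightarrow> 'r) module"
  interpret Module.module R P
    using assms by (simp add: projective_module_def)
  interpret F: Module.module R ?F
    by (rule module_free_module) (rule is_cring)
  obtain k :: "('a \<Rightarrow> 'r) \<Rightarrow> ('r \<times> 'a) list" where "inj_on k {f. finite {s. f s \<noteq> \<zero>\<^bsub>R\<^esub>}}"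
    using finite_support_encoding ..
  then have k: "inj_on k (carrier ?F)"
    by (rule inj_on_subset) auto
  \<comment> \<open>The target of the lifting problem must lie in the test type as well, so
    \<open>P\<close> itself is copied there as singleton lists.\<close>
  define j where "j x = [(\<zero>\<^bsub>R\<^esub>, x)]" for x :: 'a
  have j: "inj_on j (carrier P)"
    by (simp add: inj_on_def j_def)
  obtain e where e: "e \<in> mod_hom R ?F P" "e ` carrier ?F = carrier P"
    using free_module_cover[OF module_axioms] .
  let ?g = "\<lambda>y. j (e (inv_into (carrier ?F) k y))"
  have g: "?g \<in> mod_hom R (transport k ?F) (transport j P)"
    using mod_hom_comp[OF mod_hom_comp[OF transport_inv_hom[OF F.module_axioms k] e(1)]
        transport_hom[OF module_axioms j]] .
  have g_k: "?g (k f) = j (e f)" if "f \<in> carrier ?F" for f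
    using inv_into_f_f[OF k that] by simp
  have "?g ` carrier (transport k ?F) = (\<lambda>f. j (e f)) ` carrier ?F"
    unfolding carrier_transport image_image using g_k by (intro image_cong) auto
  also have "\<dots> = carrier (transport j P)"
    using e(2) by (simp add: image_image[symmetric])
  finally obtain h where h: "h \<in> mod_hom R P (transport k ?F)" "\<forall>x\<in>carrier P. ?g (h x) = j x"
    using assms[unfolded projective_module_def, THEN conjunct2, rule_format,
        of "transport k ?F" "transport j P" ?g j] g transport_hom[OF module_axioms j]
      module_transport[OF F.module_axioms k] module_transport[OF module_axioms j]
    by auto
  have "e (inv_into (carrier ?F) k (h x)) = x" if "x \<in> carrier P" for x
    using h(2) that by (simp add: j_def)
  then show ?thesis
    using mod_hom_comp[OF h(1) transport_inv_hom[OF F.module_axioms k]] e(1)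
    by (intro retract_ofI) auto
qed

lemma projective_module_module: "projective_module R P \<Longrightarrow> Module.module R P"
  by (simp add: projective_module_def)

text \<open>Passing through a free module removes the restriction to the test type: lifts exist
  against surjections between modules with arbitrary carriers.\<close>

lemma projective_module_lift:
  assumes "projective_module R P"
    and "Module.module R M" "Module.module R N" "g \<in> mod_hom R M N" "g ` carrier M = carrier N"
    and "f \<in> mod_hom R P N"
  obtains h where "h \<in> mod_hom R P M" "\<And>x. x \<in> carrier P \<Longrightarrow> g (h x) = f x"
  using lift_from_retract_of_free_module[OF retract_of_free_module_if_projective_module[OF assms(1)]
      assms(2-6)] by blast

lemma projective_free_module: "cring R \<Longrightarrow> projective_module R (free_module R)"
  by (rule projective_module_if_retract_of_free_module)
    (auto intro!: module_free_module retract_ofI[of "\<lambda>x. x" _ _ _ "\<lambda>x. x"] mod_homI)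

lemma projective_module_retract:
  assumes "projective_module R P" "Module.module R M" "retract_of R M P"
  shows "projective_module R M"
  using projective_module_if_retract_of_free_module[OF assms(2) retract_of_trans[OF assms(3)
        retract_of_free_module_if_projective_module[OF assms(1)]]] .

text \<open>Serves the zero modules that pad a resolution of length 0.\<close>

lemma projective_module_zero:
  fixes M :: "('r, 'a) module"
  assumes "Module.module R M" "carrier M = {\<zero>\<^bsub>M\<^esub>}"
  shows "projective_module R M"
proof -
  let ?F = "free_module R :: ('r, 'a \<Rightarrow> 'r) module"
  interpret Module.module R M by fact
  have "retract_of R M ?F"
    by (rule retract_ofI[of "\<lambda>_. \<zero>\<^bsub>?F\<^esub>" _ _ _ "\<lambda>_. \<zero>\<^bsub>M\<^esub>"])
      (use assms(2) in \<open>auto intro!: mod_homI\<close>)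
  with assms(1) show ?thesis
    by (rule projective_module_if_retract_of_free_module)
qed

text \<open>The injection \<open>k\<close> is the size condition under which a free cover of
  \<open>M\<close> fits into the prescribed type \<open>'b\<close>.\<close>

lemma transported_free_cover:
  fixes M :: "('r, 'a) module" and k :: "('a \<Rightarrow> 'r) \<Rightarrow> 'b"
  assumes "Module.module R M" "inj_on k (carrier (free_module R))"
  obtains F :: "('r, 'b) module" and e
  where "projective_module R F" "e \<in> mod_hom R F M" "e ` carrier F = carrier M"
proof -
  let ?F = "free_module R :: ('r, 'a \<Rightarrow> 'r) module"
  interpret Module.module R M by fact
  have F: "Module.module R ?F"
    by (rule module_free_module) (rule is_cring)
  obtain e where e: "e \<in> mod_hom R ?F M" "e ` carrier ?F = carrier M"
    using free_module_cover[OF assms(1)] .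
  show thesis
  proof (rule that)
    show "projective_module R (transport k ?F)"
      using projective_module_retract[OF projective_free_module[OF is_cring]
          module_transport[OF F assms(2)] transport_retract_of[OF F assms(2)]] .
    show "(\<lambda>x. e (inv_into (carrier ?F) k x)) \<in> mod_hom R (transport k ?F) M"
      by (rule mod_hom_comp[OF transport_inv_hom[OF F assms(2)] e(1)])
    show "(\<lambda>x. e (inv_into (carrier ?F) k x)) ` carrier (transport k ?F) = carrier M"
      using assms(2) e(2) by (simp add: image_image)
  qed
qed


section \<open>Resolutions of bounded length\<close>

text \<open>The type argument fixes the carriers of the resolution independently of
  \<open>M\<close>. This freedom is needed because base change alters the type of the terms.\<close>

definition finite_resolution ::
  "'b itself \<Rightarrow> ('r, 'x) ring_scheme \<Rightarrow> nat \<Rightarrow> ('r, 'a) module \<Rightarrow> bool" where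
  "finite_resolution _ R l M \<longleftrightarrow>
    (\<exists>(P :: nat \<Rightarrow> ('r, 'b) module) d e.
      projective_resolution R M P d e \<and> (\<forall>i>l. carrier (P i) = {\<zero>\<^bsub>P i\<^esub>}))"

text \<open>Inclusion between the two sets of admissible lengths reverses their infima, and this
  covers infinite dimension too, since the empty set has infimum infinity.\<close>

lemma projective_dimension_le_if_finite_resolution:
  fixes M :: "('r, 'a) module" and N :: "('s, 'b) module"
  assumes "\<And>l. finite_resolution TYPE(('s \<times> 'b) list) S l N \<Longrightarrow>
    finite_resolution TYPE(('r \<times> 'a) list) R l M"
  shows "projective_dimension R M \<le> projective_dimension S N"
proof -
  have "projective_dimension R M =
      Inf {enat l | l. finite_resolution TYPE(('r \<times> 'a) list) R l M}"
    "projective_dimension S N =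
      Inf {enat l | l. finite_resolution TYPE(('s \<times> 'b) list) S l N}"
    by (simp_all add: projective_dimension_def finite_resolution_def)
  with assms show ?thesis
    by (auto intro!: Inf_superset_mono)
qed

text \<open>Dropping the term in degree 0 leaves a resolution of the first syzygy, with
  \<open>d 0\<close> as its augmentation. With the converse below, this reduces everything to
  induction on the length.\<close>

lemma finite_resolution_SucE:
  fixes M :: "('r, 'a) module"
  assumes "finite_resolution TYPE('b) R (Suc l) M"
  obtains Q :: "('r, 'b) module" and h where
    "projective_module R Q" "h \<in> mod_hom R Q M" "h ` carrier Q = carrier M"
    "finite_resolution TYPE('b) R l (ker_module Q M h)"
proof -
  obtain P :: "nat \<Rightarrow> ('r, 'b) module" and d e
    where res: "projective_resolution R M P d e"
      and zero: "\<forall>i>Suc l. carrier (P i) = {\<zero>\<^bsub>P i\<^esub>}"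
    using assms by (auto simp: finite_resolution_def)
  have d0: "d 0 \<in> mod_hom R (P (Suc 0)) (P 0)"
    and im: "d 0 ` carrier (P (Suc 0)) = a_kernel (P 0) M e"
    using res by (auto simp: projective_resolution_def)
  have "projective_resolution R (ker_module (P 0) M e) (\<lambda>i. P (Suc i)) (\<lambda>i. d (Suc i)) (d 0)"
    using res mod_hom_into_ker_module[OF d0, of e M] im
    by (auto simp: projective_resolution_def a_kernel_eq)
  then have "finite_resolution TYPE('b) R l (ker_module (P 0) M e)"
    unfolding finite_resolution_def
    by (intro exI[of _ "\<lambda>i. P (Suc i)"] exI[of _ "\<lambda>i. d (Suc i)"] exI[of _ "d 0"])
      (use zero in simp)
  with res show thesis
    by (intro that[of "P 0" e]) (simp_all add: projective_resolution_def)
qed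

lemma finite_resolution_SucI:
  fixes M :: "('r, 'a) module" and Q :: "('r, 'b) module"
  assumes "projective_module R Q" "h \<in> mod_hom R Q M" "h ` carrier Q = carrier M"
    and "finite_resolution TYPE('b) R l (ker_module Q M h)"
  shows "finite_resolution TYPE('b) R (Suc l) M"
proof -
  obtain P :: "nat \<Rightarrow> ('r, 'b) module" and d e
    where res: "projective_resolution R (ker_module Q M h) P d e"
      and zero: "\<forall>i>l. carrier (P i) = {\<zero>\<^bsub>P i\<^esub>}"
    using assms(4) by (auto simp: finite_resolution_def)
  have e: "e \<in> mod_hom R (P 0) Q"
    using res by (auto simp: projective_resolution_def mod_hom_def a_kernel_eq Pi_iff)
  \<comment> \<open>Splicing: the augmentation \<open>e\<close> of the syzygy, read as a map into
    \<open>Q\<close>, becomes the differential in degree 0, and all other terms move up by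
    one.\<close>
  have "projective_resolution R M (case_nat Q P) (case_nat e d) h"
    using assms(1-3) e res
    by (auto simp: projective_resolution_def a_kernel_eq split: nat.splits)
  moreover have "\<forall>i>Suc l. carrier (case_nat Q P i) = {\<zero>\<^bsub>case_nat Q P i\<^esub>}"
    using zero by (auto split: nat.split)
  ultimately show ?thesis
    unfolding finite_resolution_def by (intro exI conjI)
qed

lemma finite_resolution_0I:
  fixes M :: "('r, 'a) module" and j :: "'a \<Rightarrow> 'b"
  assumes "projective_module R M" "inj_on j (carrier M)"
  shows "finite_resolution TYPE('b) R 0 M"
proof -
  interpret Module.module R M
    using assms(1) by (rule projective_module_module)
  define T where "T = transport j M"
  \<comment> \<open>The padding module is the zero submodule of the copy \<open>T\<close>, so one
    constant function can serve as every differential.\<close>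
  define Z where "Z = T\<lparr>carrier := {\<zero>\<^bsub>T\<^esub>}\<rparr>"
  define e where "e = inv_into (carrier M) j"
  have e: "e \<in> mod_hom R T M"
    unfolding e_def T_def by (rule transport_inv_hom[OF module_axioms assms(2)])
  interpret T: Module.module R T
    unfolding T_def by (rule module_transport[OF module_axioms assms(2)])
  have Z: "carrier Z = {\<zero>\<^bsub>Z\<^esub>}" "\<zero>\<^bsub>Z\<^esub> = \<zero>\<^bsub>T\<^esub>"
    "x \<oplus>\<^bsub>Z\<^esub> y = x \<oplus>\<^bsub>T\<^esub> y" "r \<odot>\<^bsub>Z\<^esub> x = r \<odot>\<^bsub>T\<^esub> x" for r x y
    by (simp_all add: Z_def)
  have "Module.module R Z"
    by (rule module_if_smult_zero) (simp_all add: Z is_cring)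
  then have "projective_module R Z"
    using Z(1) by (rule projective_module_zero)
  moreover have "projective_module R T"
    using projective_module_retract[OF assms(1) T.module_axioms]
      transport_retract_of[OF module_axioms assms(2)] by (simp add: T_def)
  moreover have "e ` carrier T = carrier M"
    using assms(2) by (simp add: e_def T_def)
  moreover have "a_kernel T M e = {\<zero>\<^bsub>T\<^esub>}"
    using assms(2) mod_hom_zero[OF T.module_axioms module_axioms e]
    by (auto simp: a_kernel_eq e_def T_def)
  moreover have "(\<lambda>_. \<zero>\<^bsub>T\<^esub>) \<in> mod_hom R Z T" "(\<lambda>_. \<zero>\<^bsub>T\<^esub>) \<in> mod_hom R Z Z"
    by (auto intro!: mod_homI simp: Z)
  ultimately have "projective_resolution R M (\<lambda>i. if i = 0 then T else Z) (\<lambda>_ _. \<zero>\<^bsub>T\<^esub>) e"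
    using e by (auto simp: projective_resolution_def a_kernel_eq Z)
  then show ?thesis
    unfolding finite_resolution_def by (intro exI conjI) (auto simp: Z)
qed

lemma projective_module_if_finite_resolution_0:
  fixes M :: "('r, 'a) module"
  assumes "finite_resolution TYPE('b) R 0 M" "Module.module R M"
  shows "projective_module R M"
proof -
  interpret Module.module R M by fact
  obtain P :: "nat \<Rightarrow> ('r, 'b) module" and d e
    where res: "projective_resolution R M P d e"
      and zero: "\<forall>i>0. carrier (P i) = {\<zero>\<^bsub>P i\<^esub>}"
    using assms(1) by (auto simp: finite_resolution_def)
  have P: "projective_module R (P 0)" "Module.module R (P 0)" "Module.module R (P 1)"
    using res by (auto simp: projective_resolution_def projective_module_def)
  interpret P: Module.module R "P 0" by fact
  have e: "e \<in> mod_hom R (P 0) M" "e ` carrier (P 0) = carrier M"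
    and d: "d 0 \<in> mod_hom R (P 1) (P 0)" "d 0 ` carrier (P 1) = a_kernel (P 0) M e"
    using res by (auto simp: projective_resolution_def)
  \<comment> \<open>The term in degree 1 is zero, so exactness makes the augmentation injective and
    \<open>M\<close> is isomorphic to \<open>P 0\<close>.\<close>
  have ker: "x = \<zero>\<^bsub>P 0\<^esub>" if "x \<in> carrier (P 0)" "e x = \<zero>\<^bsub>M\<^esub>" for x
    using that d(2) zero mod_hom_zero[OF P(3,2) d(1)] by (auto simp: a_kernel_eq)
  have "inj_on e (carrier (P 0))"
  proof (rule inj_onI)
    fix x y assume x: "x \<in> carrier (P 0)" and y: "y \<in> carrier (P 0)" and "e x = e y"
    then have "e (x \<ominus>\<^bsub>P 0\<^esub> y) = \<zero>\<^bsub>M\<^esub>"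
      using mod_hom_diff[OF P(2), of "\<lambda>x. x"] mod_hom_add[OF e(1), of "x \<ominus>\<^bsub>P 0\<^esub> y" y]
        mod_hom_closed[OF e(1)]
      by (simp add: a_minus_def P.M.a_assoc P.M.l_neg)
    then have "x \<ominus>\<^bsub>P 0\<^esub> y = \<zero>\<^bsub>P 0\<^esub>"
      using x y by (intro ker) simp_all
    moreover have "x = x \<ominus>\<^bsub>P 0\<^esub> y \<oplus>\<^bsub>P 0\<^esub> y"
      using x y by (simp add: a_minus_def P.M.a_assoc P.M.l_neg)
    ultimately show "x = y"
      using y by simp
  qed
  then have "retract_of R M (P 0)"
    using e by (intro retract_of_if_bij(2)[OF P(2) e(1)]) (simp add: bij_betw_def)
  with P(1) assms(2) show ?thesis
    by (rule projective_module_retract)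
qed


section \<open>Retracts do not increase the projective dimension\<close>

text \<open>\<open>M\<close> is a summand of the sum of \<open>N\<close> and \<open>G\<close>, but
  that sum is not formed. Lifting \<open>p1\<close> and \<open>p2\<close> through a free cover
  \<open>e\<close> of \<open>M\<close> to \<open>b1\<close> and \<open>b2\<close> makes
  \<open>b1 \<circ> i1 + b2 \<circ> i2\<close> a section of \<open>e\<close>.\<close>

lemma projective_module_stable_retract:
  fixes M :: "('r, 'a) module"
  assumes M: "Module.module R M" and N: "projective_module R N" and G: "projective_module R G"
    and i1: "i1 \<in> mod_hom R M N" and p1: "p1 \<in> mod_hom R N M"
    and i2: "i2 \<in> mod_hom R M G" and p2: "p2 \<in> mod_hom R G M"
    and split: "\<And>x. x \<in> carrier M \<Longrightarrow> p1 (i1 x) \<oplus>\<^bsub>M\<^esub> p2 (i2 x) = x"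
  shows "projective_module R M"
proof -
  let ?F = "free_module R :: ('r, 'a \<Rightarrow> 'r) module"
  interpret M: Module.module R M by fact
  have F: "Module.module R ?F"
    by (rule module_free_module) (rule M.is_cring)
  obtain e where e: "e \<in> mod_hom R ?F M" "e ` carrier ?F = carrier M"
    using free_module_cover[OF M] .
  obtain b1 where b1: "b1 \<in> mod_hom R N ?F" "\<And>x. x \<in> carrier N \<Longrightarrow> e (b1 x) = p1 x"
    by (rule projective_module_lift[OF N F M e p1]) (rule that)
  obtain b2 where b2: "b2 \<in> mod_hom R G ?F" "\<And>x. x \<in> carrier G \<Longrightarrow> e (b2 x) = p2 x"
    by (rule projective_module_lift[OF G F M e p2]) (rule that)
  have "e (b1 (i1 x) \<oplus>\<^bsub>?F\<^esub> b2 (i2 x)) = x" if "x \<in> carrier M" for x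
    using that split b1(2) b2(2) mod_hom_closed[OF i1] mod_hom_closed[OF i2]
      mod_hom_closed[OF b1(1)] mod_hom_closed[OF b2(1)]
    by (simp add: mod_hom_add[OF e(1)] del: free_module_simps)
  then have "retract_of R M ?F"
    by (rule retract_ofI[OF mod_hom_plus[OF F mod_hom_comp[OF i1 b1(1)] mod_hom_comp[OF i2 b2(1)]] e(1)])
  with projective_free_module[OF M.is_cring] M show ?thesis
    by (rule projective_module_retract)
qed

text \<open>
  Being a direct summand of \<open>N \<oplus> G\<close> for some projective \<open>G\<close> is inherited by first syzygies, and,
  unlike for direct summands of \<open>N\<close> itself, no relation between the covers of \<open>M\<close> and \<open>N\<close> is
  needed: the difference between the identity and the lifted composite \<open>b1 \<circ> a1\<close> factors through
  the cover \<open>F\<close> of \<open>M\<close>.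
\<close>

lemma syzygy_stable_retract:
  assumes M: "Module.module R M" and N: "Module.module R N" and G: "projective_module R G"
    and i1: "i1 \<in> mod_hom R M N" and p1: "p1 \<in> mod_hom R N M"
    and i2: "i2 \<in> mod_hom R M G" and p2: "p2 \<in> mod_hom R G M"
    and split: "\<And>x. x \<in> carrier M \<Longrightarrow> p1 (i1 x) \<oplus>\<^bsub>M\<^esub> p2 (i2 x) = x"
    and Q: "projective_module R Q" and h: "h \<in> mod_hom R Q N" "h ` carrier Q = carrier N"
    and F: "projective_module R F" and e: "e \<in> mod_hom R F M" "e ` carrier F = carrier M"
  obtains j1 q1 j2 q2 where
    "j1 \<in> mod_hom R (ker_module F M e) (ker_module Q N h)"
    "q1 \<in> mod_hom R (ker_module Q N h) (ker_module F M e)"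
    "j2 \<in> mod_hom R (ker_module F M e) F" "q2 \<in> mod_hom R F (ker_module F M e)"
    "\<And>x. x \<in> carrier (ker_module F M e) \<Longrightarrow> q1 (j1 x) \<oplus>\<^bsub>ker_module F M e\<^esub> q2 (j2 x) = x"
proof -
  interpret M: Module.module R M by fact
  interpret N: Module.module R N by fact
  interpret F: Module.module R F
    using F by (rule projective_module_module)
  interpret Q: Module.module R Q
    using Q by (rule projective_module_module)
  interpret G: Module.module R G
    using G by (rule projective_module_module)
  \<comment> \<open>\<open>a1\<close> and \<open>b1\<close> lift \<open>i1\<close> and
    \<open>p1\<close> to the covers and hence restrict to maps between the syzygies, but
    \<open>b1 \<circ> a1\<close> need not be the identity there.\<close>
  obtain a1 where a1: "a1 \<in> mod_hom R F Q" "\<And>x. x \<in> carrier F \<Longrightarrow> h (a1 x) = i1 (e x)"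
    by (rule projective_module_lift[OF F Q.module_axioms N h mod_hom_comp[OF e(1) i1]]) (rule that)
  obtain b1 where b1: "b1 \<in> mod_hom R Q F" "\<And>x. x \<in> carrier Q \<Longrightarrow> e (b1 x) = p1 (h x)"
    by (rule projective_module_lift[OF Q F.module_axioms M e mod_hom_comp[OF h(1) p1]]) (rule that)
  obtain b2 where b2: "b2 \<in> mod_hom R G F" "\<And>x. x \<in> carrier G \<Longrightarrow> e (b2 x) = p2 x"
    by (rule projective_module_lift[OF G F.module_axioms M e p2]) (rule that)
  note zeros = mod_hom_zero[OF M N i1] mod_hom_zero[OF N M p1]
    mod_hom_zero[OF M G.module_axioms i2] mod_hom_zero[OF G.module_axioms F.module_axioms b2(1)]
  note closed = mod_hom_closed[OF e(1)] mod_hom_closed[OF a1(1)] mod_hom_closed[OF b1(1)]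
    mod_hom_closed[OF b2(1)] mod_hom_closed[OF i1] mod_hom_closed[OF i2] mod_hom_closed[OF p1]
    mod_hom_closed[OF p2]
  \<comment> \<open>By \<open>split\<close>, this map satisfies \<open>e \<circ> ?c = e\<close>, so
    \<open>x - ?c x\<close> lies in the kernel of \<open>e\<close>. On that kernel the second
    summand vanishes and \<open>?c\<close> is \<open>b1 \<circ> a1\<close>, so \<open>x\<close> is
    the sum of \<open>b1 (a1 x)\<close> and \<open>x - ?c x\<close>.\<close>
  let ?c = "\<lambda>x. b1 (a1 x) \<oplus>\<^bsub>F\<^esub> b2 (i2 (e x))"
  have c: "?c \<in> mod_hom R F F"
    by (rule mod_hom_plus[OF F.module_axioms mod_hom_comp[OF a1(1) b1(1)]
          mod_hom_comp[OF mod_hom_comp[OF e(1) i2] b2(1)]])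
  have e_c: "e (?c x) = e x" if "x \<in> carrier F" for x
    using that split[of "e x"] by (simp add: mod_hom_add[OF e(1)] closed a1(2) b1(2) b2(2))
  have id: "(\<lambda>x. x) \<in> mod_hom R F F"
    by (rule mod_homI) simp_all
  have e_diff: "e (x \<ominus>\<^bsub>F\<^esub> ?c x) = \<zero>\<^bsub>M\<^esub>" if x: "x \<in> carrier F" for x
  proof -
    have cx: "?c x \<in> carrier F"
      using x by (rule mod_hom_closed[OF c])
    have "e (x \<ominus>\<^bsub>F\<^esub> ?c x) \<oplus>\<^bsub>M\<^esub> e (?c x) = e (x \<ominus>\<^bsub>F\<^esub> ?c x \<oplus>\<^bsub>F\<^esub> ?c x)"
      using x cx by (subst mod_hom_add[OF e(1)]) simp_all
    also have "x \<ominus>\<^bsub>F\<^esub> ?c x \<oplus>\<^bsub>F\<^esub> ?c x = x"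
      using x cx by (simp add: a_minus_def F.M.a_assoc F.M.l_neg)
    finally have "e (x \<ominus>\<^bsub>F\<^esub> ?c x) \<oplus>\<^bsub>M\<^esub> e x = e x"
      unfolding e_c[OF x] .
    then show ?thesis
      using x cx by (simp add: closed M.add.r_cancel_one)
  qed
  show thesis
  \<comment> \<open>The cover \<open>F\<close> takes the place of \<open>G\<close>: the inclusion of
    the syzygy leads into it and \<open>x - ?c x\<close> leads back.\<close>
  proof (rule that[of a1 b1 "\<lambda>x. x" "\<lambda>x. x \<ominus>\<^bsub>F\<^esub> ?c x"])
    show "a1 \<in> mod_hom R (ker_module F M e) (ker_module Q N h)"
      by (rule mod_hom_into_ker_module[OF mod_hom_from_ker_module[OF a1(1)]])
        (simp add: a_kernel_eq a1(2) zeros)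
    show "b1 \<in> mod_hom R (ker_module Q N h) (ker_module F M e)"
      by (rule mod_hom_into_ker_module[OF mod_hom_from_ker_module[OF b1(1)]])
        (simp add: a_kernel_eq b1(2) zeros)
    show "(\<lambda>x. x) \<in> mod_hom R (ker_module F M e) F"
      by (rule mod_hom_from_ker_module[OF id])
    show "(\<lambda>x. x \<ominus>\<^bsub>F\<^esub> ?c x) \<in> mod_hom R F (ker_module F M e)"
      using mod_hom_diff[OF F.module_axioms id c] e_diff by (rule mod_hom_into_ker_module)
    show "b1 (a1 x) \<oplus>\<^bsub>ker_module F M e\<^esub> (x \<ominus>\<^bsub>F\<^esub> ?c x) = x"
      if "x \<in> carrier (ker_module F M e)" for x
    proof -
      have x: "x \<in> carrier F" "e x = \<zero>\<^bsub>M\<^esub>"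
        using that by (simp_all add: a_kernel_eq)
      then have "?c x = b1 (a1 x)"
        by (simp add: zeros closed)
      with x(1) show ?thesis
        by (simp add: closed a_minus_def F.M.a_lcomm F.M.r_neg)
    qed
  qed
qed

text \<open>The induction on \<open>l\<close> replaces \<open>M\<close> and \<open>G\<close> by
  modules on the same type \<open>'a\<close>, and \<open>N\<close> by one on \<open>'b\<close>. So
  \<open>M\<close> starts on the type of the resolution to be built, and \<open>k\<close> keeps its
  free covers inside that type.\<close>

lemma finite_resolution_stable_retract:
  fixes M G :: "('r, 'a) module" and N :: "('r, 'b) module"
  assumes k: "inj_on (k :: ('a \<Rightarrow> 'r) \<Rightarrow> 'a) (carrier (free_module R))"
  shows "finite_resolution TYPE('b) R l N \<Longrightarrow> Module.module R M \<Longrightarrow> Module.module R N \<Longrightarrow>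
    projective_module R G \<Longrightarrow>
    i1 \<in> mod_hom R M N \<Longrightarrow> p1 \<in> mod_hom R N M \<Longrightarrow>
    i2 \<in> mod_hom R M G \<Longrightarrow> p2 \<in> mod_hom R G M \<Longrightarrow>
    (\<And>x. x \<in> carrier M \<Longrightarrow> p1 (i1 x) \<oplus>\<^bsub>M\<^esub> p2 (i2 x) = x) \<Longrightarrow>
    finite_resolution TYPE('a) R l M"
proof (induction l arbitrary: M N G i1 p1 i2 p2)
  case 0
  have "projective_module R N"
    using 0(1,3) by (rule projective_module_if_finite_resolution_0)
  with 0 have "projective_module R M"
    by (intro projective_module_stable_retract[of R M N G i1 p1 i2 p2]) simp_all
  then show ?case
    by (rule finite_resolution_0I[of _ _ "\<lambda>x. x"]) simp
next
  case (Suc l)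
  interpret M: Module.module R M by fact
  obtain Q :: "('r, 'b) module" and h
    where Q: "projective_module R Q" "h \<in> mod_hom R Q N" "h ` carrier Q = carrier N"
      and K: "finite_resolution TYPE('b) R l (ker_module Q N h)"
    using finite_resolution_SucE[OF Suc.prems(1)] .
  obtain F :: "('r, 'a) module" and e
    where F: "projective_module R F" "e \<in> mod_hom R F M" "e ` carrier F = carrier M"
    using transported_free_cover[OF Suc.prems(2) k] .
  obtain j1 q1 j2 q2 where *:
    "j1 \<in> mod_hom R (ker_module F M e) (ker_module Q N h)"
    "q1 \<in> mod_hom R (ker_module Q N h) (ker_module F M e)"
    "j2 \<in> mod_hom R (ker_module F M e) F" "q2 \<in> mod_hom R F (ker_module F M e)"
    "\<And>x. x \<in> carrier (ker_module F M e) \<Longrightarrow> q1 (j1 x) \<oplus>\<^bsub>ker_module F M e\<^esub> q2 (j2 x) = x"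
    using syzygy_stable_retract[OF Suc.prems(2-9) Q F] by blast
  have "finite_resolution TYPE('a) R l (ker_module F M e)"
    by (rule Suc.IH[OF K module_ker_module[OF projective_module_module[OF F(1)] Suc.prems(2) F(2)]
          module_ker_module[OF projective_module_module[OF Q(1)] Suc.prems(3) Q(2)] F(1) *])
  with F show ?case
    by (rule finite_resolution_SucI)
qed

text \<open>Here \<open>M\<close> and \<open>N\<close> live on types of their own. One syzygy step
  is done by hand, since the kernels already lie on the types of the resolutions; then the induction
  above applies.\<close>

lemma finite_resolution_retract:
  fixes M :: "('r, 'c) module" and N :: "('r, 'd) module"
    and k :: "('a \<Rightarrow> 'r) \<Rightarrow> 'a" and k' :: "('c \<Rightarrow> 'r) \<Rightarrow> 'a" and j :: "'c \<Rightarrow> 'a"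
  assumes k: "inj_on k (carrier (free_module R))" and k': "inj_on k' (carrier (free_module R))"
    and j: "inj_on j (carrier M)"
    and M: "Module.module R M" and N: "Module.module R N"
    and retract: "retract_of R M N" and res: "finite_resolution TYPE('b) R l N"
  shows "finite_resolution TYPE('a) R l M"
proof (cases l)
  case 0
  then have "projective_module R N"
    using res N by (auto intro: projective_module_if_finite_resolution_0)
  then have "projective_module R M"
    using M retract by (rule projective_module_retract)
  with j show ?thesis
    unfolding 0 by (intro finite_resolution_0I)
next
  case (Suc l')
  interpret M: Module.module R M by fact
  let ?G = "free_module R :: ('r, 'c \<Rightarrow> 'r) module"
  interpret G: Module.module R ?G
    by (rule module_free_module) (rule M.is_cring)
  obtain i p where i: "i \<in> mod_hom R M N" and p: "p \<in> mod_hom R N M"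
    and pi: "\<And>x. x \<in> carrier M \<Longrightarrow> p (i x) = x"
    using retract by (auto simp: retract_of_def)
  obtain Q :: "('r, 'b) module" and h
    where Q: "projective_module R Q" "h \<in> mod_hom R Q N" "h ` carrier Q = carrier N"
      and K: "finite_resolution TYPE('b) R l' (ker_module Q N h)"
    using finite_resolution_SucE[OF res[unfolded Suc]] .
  obtain F :: "('r, 'a) module" and e
    where F: "projective_module R F" "e \<in> mod_hom R F M" "e ` carrier F = carrier M"
    using transported_free_cover[OF M k'] .
  \<comment> \<open>A plain retraction is a splitting whose second component consists of zero maps
    through a projective module.\<close>
  have zero: "(\<lambda>_. \<zero>\<^bsub>?G\<^esub>) \<in> mod_hom R M ?G" "(\<lambda>_. \<zero>\<^bsub>M\<^esub>) \<in> mod_hom R ?G M"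
    by (auto intro!: mod_homI)
  have split: "p (i x) \<oplus>\<^bsub>M\<^esub> \<zero>\<^bsub>M\<^esub> = x" if "x \<in> carrier M" for x
    using that by (simp add: pi)
  obtain j1 q1 j2 q2 where *:
    "j1 \<in> mod_hom R (ker_module F M e) (ker_module Q N h)"
    "q1 \<in> mod_hom R (ker_module Q N h) (ker_module F M e)"
    "j2 \<in> mod_hom R (ker_module F M e) F" "q2 \<in> mod_hom R F (ker_module F M e)"
    "\<And>x. x \<in> carrier (ker_module F M e) \<Longrightarrow> q1 (j1 x) \<oplus>\<^bsub>ker_module F M e\<^esub> q2 (j2 x) = x"
    using syzygy_stable_retract[OF M N projective_free_module[OF M.is_cring] i p zero split Q F]
    by blast
  have "finite_resolution TYPE('a) R l' (ker_module F M e)"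
    by (rule finite_resolution_stable_retract[OF k K
          module_ker_module[OF projective_module_module[OF F(1)] M F(2)]
          module_ker_module[OF projective_module_module[OF Q(1)] N Q(2)] F(1) *])
  with F show ?thesis
    unfolding Suc by (rule finite_resolution_SucI)
qed


section \<open>Fitting free modules into the list type\<close>

text \<open>
  The code \<open>s x\<^sub>1 s x\<^sub>2 \<dots> s x\<^sub>k t\<close> of the list \<open>x\<^sub>1, \<dots>, x\<^sub>k\<close> is prefix-free.
\<close>

lemma list_list_encoding:
  assumes "(s :: 'x) \<noteq> t"
  shows "\<exists>k :: 'x list list \<Rightarrow> 'x list. inj k"
proof -
  define w where "w xs = concat (map (\<lambda>x. [s, x]) xs) @ [t]" for xs
  have w: "w xs @ as = w ys @ bs \<Longrightarrow> xs = ys \<and> as = bs" for xs ys as bs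
  proof (induction xs arbitrary: ys)
    case Nil
    then show ?case
      using assms by (cases ys) (auto simp: w_def)
  next
    case (Cons x xs)
    then show ?case
      using assms by (cases ys) (auto simp: w_def)
  qed
  have "concat (map w xss) = concat (map w yss) \<Longrightarrow> xss = yss" for xss yss
  proof (induction xss arbitrary: yss)
    case Nil
    then show ?case
      by (cases yss) (auto simp: w_def)
  next
    case (Cons xs xss)
    then obtain ys yss' where yss: "yss = ys # yss'"
      by (cases yss) (auto simp: w_def)
    then show ?case
      using Cons.IH[of yss'] Cons.prems w[of xs "concat (map w xss)" ys "concat (map w yss')"] by auto
  qed
  then have "inj (\<lambda>xss. concat (map w xss))"
    by (intro injI)
  then show ?thesis
    by (rule exI[of inj])
qed

text \<open>A finitely supported function on lists becomes a list of scalar-list pairs, then a list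
  of lists, then a single list. Thus the list type contains the free cover of any module it carries,
  which is what repeated syzygies require.\<close>

lemma free_module_encoding:
  fixes R :: "('r, 'x) ring_scheme"
  assumes "\<one>\<^bsub>R\<^esub> \<noteq> \<zero>\<^bsub>R\<^esub>"
  obtains k :: "(('r \<times> 'a) list \<Rightarrow> 'r) \<Rightarrow> ('r \<times> 'a) list"
  where "inj_on k (carrier (free_module R))"
proof -
  obtain f :: "(('r \<times> 'a) list \<Rightarrow> 'r) \<Rightarrow> ('r \<times> ('r \<times> 'a) list) list"
    where f: "inj_on f {f. finite {s. f s \<noteq> \<zero>\<^bsub>R\<^esub>}}"
    using finite_support_encoding ..
  \<comment> \<open>The coding needs two distinct letters; as \<open>'a\<close> may have a single
    element, the scalars 1 and 0 distinguish them.\<close>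
  obtain g :: "('r \<times> 'a) list list \<Rightarrow> ('r \<times> 'a) list" where g: "inj g"
    using list_list_encoding[of "(\<one>\<^bsub>R\<^esub>, undefined)" "(\<zero>\<^bsub>R\<^esub>, undefined)"] assms by auto
  define c where "c = (\<lambda>(r :: 'r, xs :: ('r \<times> 'a) list). (r, undefined) # xs)"
  have "inj c"
    by (auto simp: c_def inj_def)
  then have "inj (\<lambda>xs. g (map c xs))"
    using inj_compose[OF g inj_mapI] by (simp add: comp_def)
  then have "inj_on (\<lambda>h. g (map c (f h))) {f. finite {s. f s \<noteq> \<zero>\<^bsub>R\<^esub>}}"
    using f by (auto simp: inj_on_def)
  then show thesis
    by (intro that[of "\<lambda>h. g (map c (f h))"]) (auto elim: inj_on_subset)
qed

text \<open>The common frame of both inequalities: a change of rings turns resolutions of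
  \<open>N\<close> into resolutions of \<open>N'\<close> on an arbitrary type \<open>'d\<close>, and
  \<open>M\<close> is a summand of \<open>N'\<close>.\<close>

theorem projective_dimension_le_if_retract_of:
  fixes M :: "('r, 'a) module" and N :: "('s, 'b) module" and N' :: "('r, 'c) module"
  assumes "\<one>\<^bsub>R\<^esub> \<noteq> \<zero>\<^bsub>R\<^esub>" and M: "Module.module R M" and N': "Module.module R N'"
    and retract: "retract_of R M N'"
    and res: "\<And>l. finite_resolution TYPE(('s \<times> 'b) list) S l N \<Longrightarrow>
      finite_resolution TYPE('d) R l N'"
  shows "projective_dimension R M \<le> projective_dimension S N"
proof (rule projective_dimension_le_if_finite_resolution)
  fix l assume "finite_resolution TYPE(('s \<times> 'b) list) S l N"
  then have *: "finite_resolution TYPE('d) R l N'"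
    by (rule res)
  obtain k :: "(('r \<times> 'a) list \<Rightarrow> 'r) \<Rightarrow> ('r \<times> 'a) list"
    where k: "inj_on k (carrier (free_module R))"
    using free_module_encoding[OF assms(1)] .
  obtain k' :: "('a \<Rightarrow> 'r) \<Rightarrow> ('r \<times> 'a) list"
    where "inj_on k' {f. finite {s. f s \<noteq> \<zero>\<^bsub>R\<^esub>}}"
    using finite_support_encoding ..
  then have k': "inj_on k' (carrier (free_module R))"
    by (rule inj_on_subset) auto
  have "inj_on (\<lambda>x. [(\<zero>\<^bsub>R\<^esub>, x)]) (carrier M)"
    by (simp add: inj_on_def)
  from finite_resolution_retract[OF k k' this M N' retract *]
  show "finite_resolution TYPE(('r \<times> 'a) list) R l M" .
qed


section \<open>Finite free ring extensions\<close>

lemma finsum_smult_rdistr: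
  assumes "Module.module R M" "finite A" "r \<in> A \<rightarrow> carrier R" "y \<in> carrier M"
  shows "(\<Oplus>\<^bsub>R\<^esub>i\<in>A. r i) \<odot>\<^bsub>M\<^esub> y = (\<Oplus>\<^bsub>M\<^esub>i\<in>A. r i \<odot>\<^bsub>M\<^esub> y)"
proof -
  interpret Module.module R M by fact
  interpret R: cring R by (rule is_cring)
  show ?thesis
    using assms(2,3)
  proof (induction A rule: finite_induct)
    case (insert i A)
    then have "r \<in> A \<rightarrow> carrier R" "r i \<in> carrier R"
      by auto
    with insert assms(4) show ?case
      by (simp add: Pi_iff smult_l_distr)
  qed (use assms(4) in simp)
qed

lemma (in abelian_monoid) finsum_swap:
  assumes "finite A" "finite B" "\<And>a b. a \<in> A \<Longrightarrow> b \<in> B \<Longrightarrow> f a b \<in> carrier G"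
  shows "(\<Oplus>a\<in>A. \<Oplus>b\<in>B. f a b) = (\<Oplus>b\<in>B. \<Oplus>a\<in>A. f a b)"
  using assms(1,3)
proof (induction A rule: finite_induct)
  case (insert a A)
  have "(\<Oplus>b\<in>B. \<Oplus>a\<in>insert a A. f a b) = (\<Oplus>b\<in>B. f a b \<oplus> (\<Oplus>a\<in>A. f a b))"
    using insert by (intro finsum_cong') (auto simp: Pi_iff)
  also have "\<dots> = (\<Oplus>b\<in>B. f a b) \<oplus> (\<Oplus>b\<in>B. \<Oplus>a\<in>A. f a b)"
    using insert by (intro finsum_addf) (auto simp: Pi_iff)
  also have "\<dots> = (\<Oplus>a\<in>insert a A. \<Oplus>b\<in>B. f a b)"
    using insert by (simp add: Pi_iff)
  finally show ?case ..
qed simp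

lemma quot_module_carrier: "carrier (quot_module R I) = {I +>\<^bsub>R\<^esub> r | r. r \<in> carrier R}"
  by (auto simp: quot_module_def ring.defs FactRing_simps A_RCOSETS_def')

lemma
  assumes "ideal I R"
  shows quot_module_add: "r \<in> carrier R \<Longrightarrow> s \<in> carrier R \<Longrightarrow>
      (I +>\<^bsub>R\<^esub> r) \<oplus>\<^bsub>quot_module R I\<^esub> (I +>\<^bsub>R\<^esub> s) = I +>\<^bsub>R\<^esub> (r \<oplus>\<^bsub>R\<^esub> s)"
    and quot_module_smult: "r \<in> carrier R \<Longrightarrow> s \<in> carrier R \<Longrightarrow>
      r \<odot>\<^bsub>quot_module R I\<^esub> (I +>\<^bsub>R\<^esub> s) = I +>\<^bsub>R\<^esub> (r \<otimes>\<^bsub>R\<^esub> s)"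
    and quot_module_zero: "\<zero>\<^bsub>quot_module R I\<^esub> = I +>\<^bsub>R\<^esub> \<zero>\<^bsub>R\<^esub>"
proof -
  interpret ideal I R by fact
  show "(I +>\<^bsub>R\<^esub> r) \<oplus>\<^bsub>quot_module R I\<^esub> (I +>\<^bsub>R\<^esub> s) = I +>\<^bsub>R\<^esub> (r \<oplus>\<^bsub>R\<^esub> s)"
    if "r \<in> carrier R" "s \<in> carrier R"
    using that by (simp add: quot_module_def ring.defs FactRing_simps a_rcos_sum)
  show "r \<odot>\<^bsub>quot_module R I\<^esub> (I +>\<^bsub>R\<^esub> s) = I +>\<^bsub>R\<^esub> (r \<otimes>\<^bsub>R\<^esub> s)"
    if "r \<in> carrier R" "s \<in> carrier R"
    using that by (simp add: quot_module_def ring.defs FactRing_simps rcoset_mult_add)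
  show "\<zero>\<^bsub>quot_module R I\<^esub> = I +>\<^bsub>R\<^esub> \<zero>\<^bsub>R\<^esub>"
    using a_coset_add_zero[OF a_subset] by (simp add: quot_module_def ring.defs FactRing_simps)
qed

lemma a_r_coset_eq_iff:
  assumes "ideal I R" "r \<in> carrier R" "s \<in> carrier R"
  shows "I +>\<^bsub>R\<^esub> r = I +>\<^bsub>R\<^esub> s \<longleftrightarrow> r \<ominus>\<^bsub>R\<^esub> s \<in> I"
proof -
  interpret ideal I R by fact
  show ?thesis
    using quotient_eq_iff_same_a_r_cos[OF assms] by simp
qed

lemma quot_module_finsum:
  assumes "cring R" "ideal I R" "f \<in> A \<rightarrow> carrier R"
  shows "finsum (quot_module R I) (\<lambda>a. I +>\<^bsub>R\<^esub> f a) A = I +>\<^bsub>R\<^esub> (finsum R f A)"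
proof -
  interpret cring R by fact
  interpret Q: Module.module R "quot_module R I"
    by (rule module_quot_module[OF assms(1,2)])
  show ?thesis
    using assms(3)
  proof (induction A rule: infinite_finite_induct)
    case (insert a A)
    then have "f \<in> A \<rightarrow> carrier R" "f a \<in> carrier R"
      by auto
    with insert show ?case
      by (subst Q.finsum_insert)
        (auto simp: Pi_iff quot_module_carrier quot_module_add[OF assms(2)])
  qed (simp_all add: finsum_infinite Q.finsum_infinite quot_module_zero[OF assms(2)])
qed

text \<open>Only additivity is asked of \<open>f\<close>, because the target may be a module over
  another ring; linearity of the induced map is checked where it is used.\<close>

lemma quot_lift:
  assumes "cring R" "ideal I R" "Module.module S N"
    and closed: "\<And>r. r \<in> carrier R \<Longrightarrow> f r \<in> carrier N"
    and add: "\<And>r s. r \<in> carrier R \<Longrightarrow> s \<in> carrier R \<Longrightarrow> f (r \<oplus>\<^bsub>R\<^esub> s) = f r \<oplus>\<^bsub>N\<^esub> f s"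
    and zero: "\<And>r. r \<in> I \<Longrightarrow> f r = \<zero>\<^bsub>N\<^esub>"
  shows "\<exists>h. \<forall>r\<in>carrier R. h (I +>\<^bsub>R\<^esub> r) = f r"
proof -
  interpret N: Module.module S N by fact
  interpret R: cring R by fact
  have eq: "f r = f s" if "r \<in> carrier R" "s \<in> carrier R" "I +>\<^bsub>R\<^esub> r = I +>\<^bsub>R\<^esub> s" for r s
  proof -
    have "r \<ominus>\<^bsub>R\<^esub> s \<in> I"
      using that a_r_coset_eq_iff[OF assms(2)] by simp
    then have "f (r \<ominus>\<^bsub>R\<^esub> s \<oplus>\<^bsub>R\<^esub> s) = f s"
      using that closed by (simp add: add zero)
    moreover have "r \<ominus>\<^bsub>R\<^esub> s \<oplus>\<^bsub>R\<^esub> s = r"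
      using that by (simp add: a_minus_def R.a_assoc R.l_neg)
    ultimately show ?thesis
      by simp
  qed
  show ?thesis
  proof (intro exI ballI)
    fix r assume r: "r \<in> carrier R"
    let ?s = "SOME s. s \<in> carrier R \<and> I +>\<^bsub>R\<^esub> s = I +>\<^bsub>R\<^esub> r"
    have "?s \<in> carrier R \<and> I +>\<^bsub>R\<^esub> ?s = I +>\<^bsub>R\<^esub> r"
      by (rule someI_ex) (use r in blast)
    with r eq show "(\<lambda>C. f (SOME s. s \<in> carrier R \<and> I +>\<^bsub>R\<^esub> s = C)) (I +>\<^bsub>R\<^esub> r) = f r"
      by blast
  qed
qed

text \<open>\<open>R\<close> is a free \<open>S\<close>-module along \<open>\<phi>\<close> with
  basis \<open>x\<close>, and the \<open>\<kappa> a\<close> are the dual coordinate functionals.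
  Having 1 in the basis, at \<open>a\<^sub>0\<close>, makes \<open>\<kappa> a\<^sub>0\<close> an
  \<open>S\<close>-linear left inverse of \<open>\<phi>\<close>. The two rings are kept apart
  although they coincide in the application.\<close>

locale finite_free_extension = S: cring S + R: cring R
  for S :: "('s, 'x) ring_scheme" and R :: "('r, 'y) ring_scheme" +
  fixes \<phi> :: "'s \<Rightarrow> 'r" and A :: "'e set" and x :: "'e \<Rightarrow> 'r" and \<kappa> :: "'e \<Rightarrow> 'r \<Rightarrow> 's" and a\<^sub>0 :: 'e
  assumes hom: "\<phi> \<in> ring_hom S R"
    and finite_basis: "finite A"
    and basis_closed [simp]: "a \<in> A \<Longrightarrow> x a \<in> carrier R"
    and coord_closed [simp]: "a \<in> A \<Longrightarrow> f \<in> carrier R \<Longrightarrow> \<kappa> a f \<in> carrier S"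
    and coord_add: "a \<in> A \<Longrightarrow> f \<in> carrier R \<Longrightarrow> g \<in> carrier R \<Longrightarrow>
      \<kappa> a (f \<oplus>\<^bsub>R\<^esub> g) = \<kappa> a f \<oplus>\<^bsub>S\<^esub> \<kappa> a g"
    and coord_smult: "a \<in> A \<Longrightarrow> s \<in> carrier S \<Longrightarrow> f \<in> carrier R \<Longrightarrow>
      \<kappa> a (\<phi> s \<otimes>\<^bsub>R\<^esub> f) = s \<otimes>\<^bsub>S\<^esub> \<kappa> a f"
    and coord_basis: "a \<in> A \<Longrightarrow> b \<in> A \<Longrightarrow> \<kappa> a (x b) = (if a = b then \<one>\<^bsub>S\<^esub> else \<zero>\<^bsub>S\<^esub>)"
    and expand: "f \<in> carrier R \<Longrightarrow> (\<Oplus>\<^bsub>R\<^esub>a\<in>A. x a \<otimes>\<^bsub>R\<^esub> \<phi> (\<kappa> a f)) = f"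
    and one_index: "a\<^sub>0 \<in> A"
    and basis_one: "x a\<^sub>0 = \<one>\<^bsub>R\<^esub>"
begin

lemma phi_closed [simp]: "s \<in> carrier S \<Longrightarrow> \<phi> s \<in> carrier R"
  by (rule ring_hom_closed[OF hom])

lemma phi_zero [simp]: "\<phi> \<zero>\<^bsub>S\<^esub> = \<zero>\<^bsub>R\<^esub>"
  using hom S.ring_axioms R.ring_axioms by (rule ring_hom_zero)

lemma coord_zero [simp]: "a \<in> A \<Longrightarrow> \<kappa> a \<zero>\<^bsub>R\<^esub> = \<zero>\<^bsub>S\<^esub>"
  using coord_smult[of a "\<zero>\<^bsub>S\<^esub>" "\<zero>\<^bsub>R\<^esub>"] by simp

lemma coord_finsum:
  assumes "a \<in> A" "f \<in> B \<rightarrow> carrier R"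
  shows "\<kappa> a (finsum R f B) = (\<Oplus>\<^bsub>S\<^esub>b\<in>B. \<kappa> a (f b))"
  using assms(2)
proof (induction B rule: infinite_finite_induct)
  case (insert b B)
  then have "f \<in> B \<rightarrow> carrier R" "f b \<in> carrier R"
    by auto
  with insert assms(1) show ?case
    by (simp add: Pi_iff coord_add)
qed (use assms(1) in \<open>simp_all add: S.finsum_infinite R.finsum_infinite\<close>)

lemma coord_expansion:
  assumes "a \<in> A" "\<And>b. b \<in> A \<Longrightarrow> s b \<in> carrier S"
  shows "\<kappa> a (\<Oplus>\<^bsub>R\<^esub>b\<in>A. x b \<otimes>\<^bsub>R\<^esub> \<phi> (s b)) = s a"
proof -
  have "\<kappa> a (\<Oplus>\<^bsub>R\<^esub>b\<in>A. x b \<otimes>\<^bsub>R\<^esub> \<phi> (s b)) = (\<Oplus>\<^bsub>S\<^esub>b\<in>A. \<kappa> a (x b \<otimes>\<^bsub>R\<^esub> \<phi> (s b)))"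
    using assms by (intro coord_finsum) auto
  also have "\<dots> = (\<Oplus>\<^bsub>S\<^esub>b\<in>A. if a = b then s b else \<zero>\<^bsub>S\<^esub>)"
    using assms by (intro S.finsum_cong')
      (auto simp: R.m_comm[of "x _" "\<phi> _"] coord_smult coord_basis)
  also have "\<dots> = s a"
    using assms finite_basis by (intro S.finsum_singleton) auto
  finally show ?thesis .
qed

lemma coord_mult:
  assumes "c \<in> A" "f \<in> carrier R" "g \<in> carrier R"
  shows "\<kappa> c (f \<otimes>\<^bsub>R\<^esub> g) = (\<Oplus>\<^bsub>S\<^esub>b\<in>A. \<kappa> c (x b \<otimes>\<^bsub>R\<^esub> f) \<otimes>\<^bsub>S\<^esub> \<kappa> b g)"
proof -
  have "f \<otimes>\<^bsub>R\<^esub> g = f \<otimes>\<^bsub>R\<^esub> (\<Oplus>\<^bsub>R\<^esub>b\<in>A. x b \<otimes>\<^bsub>R\<^esub> \<phi> (\<kappa> b g))"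
    using assms by (simp add: expand)
  also have "\<dots> = (\<Oplus>\<^bsub>R\<^esub>b\<in>A. f \<otimes>\<^bsub>R\<^esub> (x b \<otimes>\<^bsub>R\<^esub> \<phi> (\<kappa> b g)))"
    using assms finite_basis by (intro R.finsum_rdistr) auto
  also have "\<dots> = (\<Oplus>\<^bsub>R\<^esub>b\<in>A. \<phi> (\<kappa> b g) \<otimes>\<^bsub>R\<^esub> (x b \<otimes>\<^bsub>R\<^esub> f))"
    using assms by (intro R.finsum_cong') (auto simp: R.m_ac)
  also have "\<kappa> c \<dots> = (\<Oplus>\<^bsub>S\<^esub>b\<in>A. \<kappa> c (\<phi> (\<kappa> b g) \<otimes>\<^bsub>R\<^esub> (x b \<otimes>\<^bsub>R\<^esub> f)))"
    using assms by (intro coord_finsum) auto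
  also have "\<dots> = (\<Oplus>\<^bsub>S\<^esub>b\<in>A. \<kappa> c (x b \<otimes>\<^bsub>R\<^esub> f) \<otimes>\<^bsub>S\<^esub> \<kappa> b g)"
    using assms by (intro S.finsum_cong') (auto simp: coord_smult S.m_comm)
  finally show ?thesis .
qed


subsection \<open>Restriction of scalars\<close>

definition restrict_scalars :: "('r, 'a) module \<Rightarrow> ('s, 'a) module" where
  "restrict_scalars N =
    \<lparr>carrier = carrier N, mult = mult N, one = one N, zero = zero N, add = add N,
     smult = (\<lambda>s. smult N (\<phi> s))\<rparr>"

lemma restrict_scalars_simps [simp]:
  "carrier (restrict_scalars N) = carrier N"
  "\<zero>\<^bsub>restrict_scalars N\<^esub> = \<zero>\<^bsub>N\<^esub>"
  "y \<oplus>\<^bsub>restrict_scalars N\<^esub> z = y \<oplus>\<^bsub>N\<^esub> z"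
  "s \<odot>\<^bsub>restrict_scalars N\<^esub> y = \<phi> s \<odot>\<^bsub>N\<^esub> y"
  by (simp_all add: restrict_scalars_def)

lemma module_restrict_scalars:
  assumes "Module.module R N"
  shows "Module.module S (restrict_scalars N)"
proof -
  interpret Module.module R N by fact
  show ?thesis
    by (intro module_if_smult_zero)
      (auto simp: S.is_cring M.a_ac smult_l_distr smult_r_distr smult_assoc1
        ring_hom_add[OF hom] ring_hom_mult[OF hom] ring_hom_one[OF hom])
qed

lemma mod_hom_restrict_scalars:
  "h \<in> mod_hom R M N \<Longrightarrow> h \<in> mod_hom S (restrict_scalars M) (restrict_scalars N)"
  by (auto simp: mod_hom_def Pi_iff)

lemma retract_of_restrict_scalars:
  "retract_of R M N \<Longrightarrow> retract_of S (restrict_scalars M) (restrict_scalars N)"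
  unfolding retract_of_def by (auto intro!: bexI dest: mod_hom_restrict_scalars)

text \<open>Each entry is replaced by its coordinates. Indices run over the type
  \<open>'t \<times> 'e\<close>, and places outside \<open>A\<close> are filled with zero, so the
  result is a retract of the free module.\<close>

lemma restrict_scalars_free_module:
  "retract_of S (restrict_scalars (free_module R :: ('r, 't \<Rightarrow> 'r) module))
    (free_module S :: ('s, 't \<times> 'e \<Rightarrow> 's) module)"
proof (rule retract_ofI)
  let ?F = "free_module R :: ('r, 't \<Rightarrow> 'r) module"
  let ?G = "free_module S :: ('s, 't \<times> 'e \<Rightarrow> 's) module"
  show "(\<lambda>f (t, a). if a \<in> A then \<kappa> a (f t) else \<zero>\<^bsub>S\<^esub>) \<in> mod_hom S (restrict_scalars ?F) ?G"
  proof (rule mod_homI)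
    fix f assume f: "f \<in> carrier (restrict_scalars ?F)"
    have "finite ({t. f t \<noteq> \<zero>\<^bsub>R\<^esub>} \<times> A)"
      using f finite_basis by simp
    then have "finite {u. (case u of (t, a) \<Rightarrow> if a \<in> A then \<kappa> a (f t) else \<zero>\<^bsub>S\<^esub>) \<noteq> \<zero>\<^bsub>S\<^esub>}"
      by (rule rev_finite_subset) (auto split: if_splits)
    then show "(\<lambda>(t, a). if a \<in> A then \<kappa> a (f t) else \<zero>\<^bsub>S\<^esub>) \<in> carrier ?G"
      unfolding free_module_simps using f by (auto split: prod.split)
  qed (auto simp: fun_eq_iff coord_add coord_smult)
  show "(\<lambda>g t. \<Oplus>\<^bsub>R\<^esub>a\<in>A. x a \<otimes>\<^bsub>R\<^esub> \<phi> (g (t, a))) \<in> mod_hom S ?G (restrict_scalars ?F)"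
  proof (rule mod_homI)
    fix g assume g: "g \<in> carrier ?G"
    have "finite (fst ` {u. g u \<noteq> \<zero>\<^bsub>S\<^esub>})"
      using g by simp
    moreover have "{t. (\<Oplus>\<^bsub>R\<^esub>a\<in>A. x a \<otimes>\<^bsub>R\<^esub> \<phi> (g (t, a))) \<noteq> \<zero>\<^bsub>R\<^esub>} \<subseteq> fst ` {u. g u \<noteq> \<zero>\<^bsub>S\<^esub>}"
    proof
      fix t assume t: "t \<in> {t. (\<Oplus>\<^bsub>R\<^esub>a\<in>A. x a \<otimes>\<^bsub>R\<^esub> \<phi> (g (t, a))) \<noteq> \<zero>\<^bsub>R\<^esub>}"
      have "(\<Oplus>\<^bsub>R\<^esub>a\<in>A. x a \<otimes>\<^bsub>R\<^esub> \<phi> (g (t, a))) = \<zero>\<^bsub>R\<^esub>" if "\<forall>a\<in>A. g (t, a) = \<zero>\<^bsub>S\<^esub>"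
        using that by (intro R.add.finprod_one_eqI) auto
      with t have "\<exists>a\<in>A. g (t, a) \<noteq> \<zero>\<^bsub>S\<^esub>"
        by auto
      then show "t \<in> fst ` {u. g u \<noteq> \<zero>\<^bsub>S\<^esub>}"
        by force
    qed
    ultimately show "(\<lambda>t. \<Oplus>\<^bsub>R\<^esub>a\<in>A. x a \<otimes>\<^bsub>R\<^esub> \<phi> (g (t, a))) \<in> carrier (restrict_scalars ?F)"
      using g by (auto intro: finite_subset)
  next
    fix g g' assume g: "g \<in> carrier ?G" and g': "g' \<in> carrier ?G"
    show "(\<lambda>t. \<Oplus>\<^bsub>R\<^esub>a\<in>A. x a \<otimes>\<^bsub>R\<^esub> \<phi> ((g \<oplus>\<^bsub>?G\<^esub> g') (t, a))) =
        (\<lambda>t. \<Oplus>\<^bsub>R\<^esub>a\<in>A. x a \<otimes>\<^bsub>R\<^esub> \<phi> (g (t, a))) \<oplus>\<^bsub>restrict_scalars ?F\<^esub>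
        (\<lambda>t. \<Oplus>\<^bsub>R\<^esub>a\<in>A. x a \<otimes>\<^bsub>R\<^esub> \<phi> (g' (t, a)))"
    proof
      fix t
      have "(\<Oplus>\<^bsub>R\<^esub>a\<in>A. x a \<otimes>\<^bsub>R\<^esub> \<phi> (g (t, a) \<oplus>\<^bsub>S\<^esub> g' (t, a))) =
          (\<Oplus>\<^bsub>R\<^esub>a\<in>A. x a \<otimes>\<^bsub>R\<^esub> \<phi> (g (t, a)) \<oplus>\<^bsub>R\<^esub> x a \<otimes>\<^bsub>R\<^esub> \<phi> (g' (t, a)))"
        using g g' by (intro R.finsum_cong') (auto simp: ring_hom_add[OF hom] R.r_distr)
      also have "\<dots> = (\<Oplus>\<^bsub>R\<^esub>a\<in>A. x a \<otimes>\<^bsub>R\<^esub> \<phi> (g (t, a))) \<oplus>\<^bsub>R\<^esub>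
          (\<Oplus>\<^bsub>R\<^esub>a\<in>A. x a \<otimes>\<^bsub>R\<^esub> \<phi> (g' (t, a)))"
        using g g' by (intro R.finsum_addf) auto
      finally show "(\<Oplus>\<^bsub>R\<^esub>a\<in>A. x a \<otimes>\<^bsub>R\<^esub> \<phi> ((g \<oplus>\<^bsub>?G\<^esub> g') (t, a))) =
        ((\<lambda>t. \<Oplus>\<^bsub>R\<^esub>a\<in>A. x a \<otimes>\<^bsub>R\<^esub> \<phi> (g (t, a))) \<oplus>\<^bsub>restrict_scalars ?F\<^esub>
        (\<lambda>t. \<Oplus>\<^bsub>R\<^esub>a\<in>A. x a \<otimes>\<^bsub>R\<^esub> \<phi> (g' (t, a)))) t"
        by simp
    qed
  next
    fix s g assume s: "s \<in> carrier S" and g: "g \<in> carrier ?G"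
    show "(\<lambda>t. \<Oplus>\<^bsub>R\<^esub>a\<in>A. x a \<otimes>\<^bsub>R\<^esub> \<phi> ((s \<odot>\<^bsub>?G\<^esub> g) (t, a))) =
        s \<odot>\<^bsub>restrict_scalars ?F\<^esub> (\<lambda>t. \<Oplus>\<^bsub>R\<^esub>a\<in>A. x a \<otimes>\<^bsub>R\<^esub> \<phi> (g (t, a)))"
    proof
      fix t
      have "(\<Oplus>\<^bsub>R\<^esub>a\<in>A. x a \<otimes>\<^bsub>R\<^esub> \<phi> (s \<otimes>\<^bsub>S\<^esub> g (t, a))) =
          (\<Oplus>\<^bsub>R\<^esub>a\<in>A. \<phi> s \<otimes>\<^bsub>R\<^esub> (x a \<otimes>\<^bsub>R\<^esub> \<phi> (g (t, a))))"
        using s g by (intro R.finsum_cong') (auto simp: ring_hom_mult[OF hom] R.m_lcomm)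
      also have "\<dots> = \<phi> s \<otimes>\<^bsub>R\<^esub> (\<Oplus>\<^bsub>R\<^esub>a\<in>A. x a \<otimes>\<^bsub>R\<^esub> \<phi> (g (t, a)))"
        using s g finite_basis by (intro R.finsum_rdistr[symmetric]) auto
      finally show "(\<Oplus>\<^bsub>R\<^esub>a\<in>A. x a \<otimes>\<^bsub>R\<^esub> \<phi> ((s \<odot>\<^bsub>?G\<^esub> g) (t, a))) =
          (s \<odot>\<^bsub>restrict_scalars ?F\<^esub> (\<lambda>t. \<Oplus>\<^bsub>R\<^esub>a\<in>A. x a \<otimes>\<^bsub>R\<^esub> \<phi> (g (t, a)))) t"
        by simp
    qed
  qed
  fix f assume f: "f \<in> carrier (restrict_scalars ?F)"
  show "(\<lambda>t. \<Oplus>\<^bsub>R\<^esub>a\<in>A. x a \<otimes>\<^bsub>R\<^esub> \<phi> ((\<lambda>(t, a). if a \<in> A then \<kappa> a (f t) else \<zero>\<^bsub>S\<^esub>) (t, a))) = f"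
  proof
    fix t
    have "(\<Oplus>\<^bsub>R\<^esub>a\<in>A. x a \<otimes>\<^bsub>R\<^esub> \<phi> (if a \<in> A then \<kappa> a (f t) else \<zero>\<^bsub>S\<^esub>)) =
        (\<Oplus>\<^bsub>R\<^esub>a\<in>A. x a \<otimes>\<^bsub>R\<^esub> \<phi> (\<kappa> a (f t)))"
      using f by (intro R.finsum_cong') auto
    then show "(\<Oplus>\<^bsub>R\<^esub>a\<in>A. x a \<otimes>\<^bsub>R\<^esub> \<phi> ((\<lambda>(t, a). if a \<in> A then \<kappa> a (f t) else \<zero>\<^bsub>S\<^esub>) (t, a))) = f t"
      using f expand[of "f t"] by simp
  qed
qed

lemma projective_module_restrict_scalars:
  assumes "projective_module R P"
  shows "projective_module S (restrict_scalars P)"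
  using projective_module_if_retract_of_free_module[OF
      module_restrict_scalars[OF projective_module_module[OF assms]]
      retract_of_trans[OF retract_of_restrict_scalars[OF
          retract_of_free_module_if_projective_module[OF assms]] restrict_scalars_free_module]] .

text \<open>Carriers, maps and kernels stay the same, so exactness is unchanged and only
  projectivity has to be proved.\<close>

lemma finite_resolution_restrict_scalars:
  fixes M :: "('r, 'a) module"
  assumes "finite_resolution TYPE('b) R l M"
  shows "finite_resolution TYPE('b) S l (restrict_scalars M)"
proof -
  obtain P :: "nat \<Rightarrow> ('r, 'b) module" and d e
    where "projective_resolution R M P d e" and zero: "\<forall>i>l. carrier (P i) = {\<zero>\<^bsub>P i\<^esub>}"
    using assms by (auto simp: finite_resolution_def)
  then have "projective_resolution S (restrict_scalars M) (\<lambda>i. restrict_scalars (P i)) d e"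
    by (simp add: projective_resolution_def projective_module_restrict_scalars
        mod_hom_restrict_scalars a_kernel_eq)
  with zero show ?thesis
    unfolding finite_resolution_def by (intro exI conjI) auto
qed


subsection \<open>Base change\<close>

text \<open>
  The tensor product of \<open>R\<close> and \<open>M\<close> over \<open>S\<close>: the family \<open>m\<close> stands for the sum of the
  \<open>x a \<otimes> m a\<close>, and \<open>f\<close> acts by the matrix of its multiplication on \<open>R\<close> in the basis \<open>x\<close>.
\<close>

definition base_change :: "('s, 'a) module \<Rightarrow> ('r, 'e \<Rightarrow> 'a) module" where
  "base_change M =
    \<lparr>carrier = A \<rightarrow>\<^sub>E carrier M, mult = (\<lambda>_ _. \<lambda>a\<in>A. \<zero>\<^bsub>M\<^esub>), one = (\<lambda>a\<in>A. \<zero>\<^bsub>M\<^esub>),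
     zero = (\<lambda>a\<in>A. \<zero>\<^bsub>M\<^esub>), add = (\<lambda>m m'. \<lambda>a\<in>A. m a \<oplus>\<^bsub>M\<^esub> m' a),
     smult = (\<lambda>f m. \<lambda>c\<in>A. \<Oplus>\<^bsub>M\<^esub>a\<in>A. \<kappa> c (x a \<otimes>\<^bsub>R\<^esub> f) \<odot>\<^bsub>M\<^esub> m a)\<rparr>"

lemma base_change_simps [simp]:
  "carrier (base_change M) = A \<rightarrow>\<^sub>E carrier M"
  "\<zero>\<^bsub>base_change M\<^esub> = (\<lambda>a\<in>A. \<zero>\<^bsub>M\<^esub>)"
  "m \<oplus>\<^bsub>base_change M\<^esub> m' = (\<lambda>a\<in>A. m a \<oplus>\<^bsub>M\<^esub> m' a)"
  "f \<odot>\<^bsub>base_change M\<^esub> m = (\<lambda>c\<in>A. \<Oplus>\<^bsub>M\<^esub>a\<in>A. \<kappa> c (x a \<otimes>\<^bsub>R\<^esub> f) \<odot>\<^bsub>M\<^esub> m a)"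
  by (simp_all add: base_change_def)

text \<open>The action laws are matrix identities: \<open>coord_mult\<close> gives the matrix of a
  product as the product of the matrices, and \<open>coord_basis\<close> gives the identity matrix
  for 1.\<close>

lemma module_base_change:
  assumes "Module.module S M"
  shows "Module.module R (base_change M)"
proof -
  interpret Module.module S M by fact
  show ?thesis
  proof (rule module_if_smult_zero)
    fix f m assume f: "f \<in> carrier R" and m: "m \<in> carrier (base_change M)"
    then show "f \<odot>\<^bsub>base_change M\<^esub> m \<in> carrier (base_change M)"
      by (auto simp: PiE_iff intro!: M.finsum_closed)
  next
    fix f g m assume f: "f \<in> carrier R" and g: "g \<in> carrier R" and m: "m \<in> carrier (base_change M)"
    then have m': "m a \<in> carrier M" if "a \<in> A" for a
      using that by (auto simp: PiE_iff)
    show "(f \<oplus>\<^bsub>R\<^esub> g) \<odot>\<^bsub>base_change M\<^esub> m =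
        (f \<odot>\<^bsub>base_change M\<^esub> m) \<oplus>\<^bsub>base_change M\<^esub> (g \<odot>\<^bsub>base_change M\<^esub> m)"
      unfolding base_change_simps
    proof (rule restrict_ext)
      fix c assume c: "c \<in> A"
      have "(\<Oplus>\<^bsub>M\<^esub>a\<in>A. \<kappa> c (x a \<otimes>\<^bsub>R\<^esub> (f \<oplus>\<^bsub>R\<^esub> g)) \<odot>\<^bsub>M\<^esub> m a) =
          (\<Oplus>\<^bsub>M\<^esub>a\<in>A. \<kappa> c (x a \<otimes>\<^bsub>R\<^esub> f) \<odot>\<^bsub>M\<^esub> m a \<oplus>\<^bsub>M\<^esub> \<kappa> c (x a \<otimes>\<^bsub>R\<^esub> g) \<odot>\<^bsub>M\<^esub> m a)"
        using f g m' c
        by (intro M.finsum_cong') (auto simp: R.r_distr coord_add smult_l_distr)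
      also have "\<dots> = (\<Oplus>\<^bsub>M\<^esub>a\<in>A. \<kappa> c (x a \<otimes>\<^bsub>R\<^esub> f) \<odot>\<^bsub>M\<^esub> m a) \<oplus>\<^bsub>M\<^esub>
          (\<Oplus>\<^bsub>M\<^esub>a\<in>A. \<kappa> c (x a \<otimes>\<^bsub>R\<^esub> g) \<odot>\<^bsub>M\<^esub> m a)"
        using f g m' c by (intro M.finsum_addf) auto
      finally show "(\<Oplus>\<^bsub>M\<^esub>a\<in>A. \<kappa> c (x a \<otimes>\<^bsub>R\<^esub> (f \<oplus>\<^bsub>R\<^esub> g)) \<odot>\<^bsub>M\<^esub> m a) =
          (\<lambda>c\<in>A. \<Oplus>\<^bsub>M\<^esub>a\<in>A. \<kappa> c (x a \<otimes>\<^bsub>R\<^esub> f) \<odot>\<^bsub>M\<^esub> m a) c \<oplus>\<^bsub>M\<^esub>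
          (\<lambda>c\<in>A. \<Oplus>\<^bsub>M\<^esub>a\<in>A. \<kappa> c (x a \<otimes>\<^bsub>R\<^esub> g) \<odot>\<^bsub>M\<^esub> m a) c"
        using c by simp
    qed
    show "(f \<otimes>\<^bsub>R\<^esub> g) \<odot>\<^bsub>base_change M\<^esub> m = f \<odot>\<^bsub>base_change M\<^esub> (g \<odot>\<^bsub>base_change M\<^esub> m)"
      unfolding base_change_simps
    proof (rule restrict_ext)
      fix c assume c: "c \<in> A"
      let ?k = "\<lambda>b. \<kappa> c (x b \<otimes>\<^bsub>R\<^esub> f)"
      have "(\<Oplus>\<^bsub>M\<^esub>a\<in>A. \<kappa> c (x a \<otimes>\<^bsub>R\<^esub> (f \<otimes>\<^bsub>R\<^esub> g)) \<odot>\<^bsub>M\<^esub> m a) =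
          (\<Oplus>\<^bsub>M\<^esub>a\<in>A. \<Oplus>\<^bsub>M\<^esub>b\<in>A. ?k b \<odot>\<^bsub>M\<^esub> (\<kappa> b (x a \<otimes>\<^bsub>R\<^esub> g) \<odot>\<^bsub>M\<^esub> m a))"
      proof (rule M.finsum_cong')
        fix a assume a: "a \<in> A"
        have "\<kappa> c (x a \<otimes>\<^bsub>R\<^esub> (f \<otimes>\<^bsub>R\<^esub> g)) = (\<Oplus>\<^bsub>S\<^esub>b\<in>A. ?k b \<otimes>\<^bsub>S\<^esub> \<kappa> b (x a \<otimes>\<^bsub>R\<^esub> g))"
          using coord_mult[OF c f, of "x a \<otimes>\<^bsub>R\<^esub> g"] f g a by (simp add: R.m_lcomm)
        then show "\<kappa> c (x a \<otimes>\<^bsub>R\<^esub> (f \<otimes>\<^bsub>R\<^esub> g)) \<odot>\<^bsub>M\<^esub> m a =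
            (\<Oplus>\<^bsub>M\<^esub>b\<in>A. ?k b \<odot>\<^bsub>M\<^esub> (\<kappa> b (x a \<otimes>\<^bsub>R\<^esub> g) \<odot>\<^bsub>M\<^esub> m a))"
          using c f g a m' finite_basis
          by (auto simp: finsum_smult_rdistr[OF assms] smult_assoc1 Pi_iff intro!: M.finsum_cong')
      qed (use c f g m' in auto)
      also have "\<dots> = (\<Oplus>\<^bsub>M\<^esub>b\<in>A. \<Oplus>\<^bsub>M\<^esub>a\<in>A. ?k b \<odot>\<^bsub>M\<^esub> (\<kappa> b (x a \<otimes>\<^bsub>R\<^esub> g) \<odot>\<^bsub>M\<^esub> m a))"
        using c f g m' finite_basis by (intro M.finsum_swap) auto
      also have "\<dots> = (\<Oplus>\<^bsub>M\<^esub>b\<in>A. ?k b \<odot>\<^bsub>M\<^esub>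
          (\<lambda>c\<in>A. \<Oplus>\<^bsub>M\<^esub>a\<in>A. \<kappa> c (x a \<otimes>\<^bsub>R\<^esub> g) \<odot>\<^bsub>M\<^esub> m a) b)"
        using c f g m' finite_basis
        by (intro M.finsum_cong') (auto simp: finsum_smult_ldistr Pi_iff)
      finally show "(\<Oplus>\<^bsub>M\<^esub>a\<in>A. \<kappa> c (x a \<otimes>\<^bsub>R\<^esub> (f \<otimes>\<^bsub>R\<^esub> g)) \<odot>\<^bsub>M\<^esub> m a) =
          (\<Oplus>\<^bsub>M\<^esub>b\<in>A. ?k b \<odot>\<^bsub>M\<^esub> (\<lambda>c\<in>A. \<Oplus>\<^bsub>M\<^esub>a\<in>A. \<kappa> c (x a \<otimes>\<^bsub>R\<^esub> g) \<odot>\<^bsub>M\<^esub> m a) b)" .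
    qed
  next
    fix f m m'
    assume f: "f \<in> carrier R" and "m \<in> carrier (base_change M)" "m' \<in> carrier (base_change M)"
    then have m: "m a \<in> carrier M" "m' a \<in> carrier M" if "a \<in> A" for a
      using that by (auto simp: PiE_iff)
    show "f \<odot>\<^bsub>base_change M\<^esub> (m \<oplus>\<^bsub>base_change M\<^esub> m') =
        (f \<odot>\<^bsub>base_change M\<^esub> m) \<oplus>\<^bsub>base_change M\<^esub> (f \<odot>\<^bsub>base_change M\<^esub> m')"
      unfolding base_change_simps
    proof (rule restrict_ext)
      fix c assume c: "c \<in> A"
      have "(\<Oplus>\<^bsub>M\<^esub>a\<in>A. \<kappa> c (x a \<otimes>\<^bsub>R\<^esub> f) \<odot>\<^bsub>M\<^esub> (\<lambda>a\<in>A. m a \<oplus>\<^bsub>M\<^esub> m' a) a) =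
          (\<Oplus>\<^bsub>M\<^esub>a\<in>A. \<kappa> c (x a \<otimes>\<^bsub>R\<^esub> f) \<odot>\<^bsub>M\<^esub> m a \<oplus>\<^bsub>M\<^esub> \<kappa> c (x a \<otimes>\<^bsub>R\<^esub> f) \<odot>\<^bsub>M\<^esub> m' a)"
        using f m c by (intro M.finsum_cong') (auto simp: smult_r_distr)
      also have "\<dots> = (\<Oplus>\<^bsub>M\<^esub>a\<in>A. \<kappa> c (x a \<otimes>\<^bsub>R\<^esub> f) \<odot>\<^bsub>M\<^esub> m a) \<oplus>\<^bsub>M\<^esub>
          (\<Oplus>\<^bsub>M\<^esub>a\<in>A. \<kappa> c (x a \<otimes>\<^bsub>R\<^esub> f) \<odot>\<^bsub>M\<^esub> m' a)"
        using f m c by (intro M.finsum_addf) auto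
      finally show "(\<Oplus>\<^bsub>M\<^esub>a\<in>A. \<kappa> c (x a \<otimes>\<^bsub>R\<^esub> f) \<odot>\<^bsub>M\<^esub> (\<lambda>a\<in>A. m a \<oplus>\<^bsub>M\<^esub> m' a) a) =
          (\<lambda>c\<in>A. \<Oplus>\<^bsub>M\<^esub>a\<in>A. \<kappa> c (x a \<otimes>\<^bsub>R\<^esub> f) \<odot>\<^bsub>M\<^esub> m a) c \<oplus>\<^bsub>M\<^esub>
          (\<lambda>c\<in>A. \<Oplus>\<^bsub>M\<^esub>a\<in>A. \<kappa> c (x a \<otimes>\<^bsub>R\<^esub> f) \<odot>\<^bsub>M\<^esub> m' a) c"
        using c by simp
    qed
  next
    fix m assume m: "m \<in> carrier (base_change M)"
    then have m': "m a \<in> carrier M" if "a \<in> A" for a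
      using that by (auto simp: PiE_iff)
    have "(\<Oplus>\<^bsub>M\<^esub>a\<in>A. \<kappa> c (x a \<otimes>\<^bsub>R\<^esub> \<one>\<^bsub>R\<^esub>) \<odot>\<^bsub>M\<^esub> m a) = m c" if c: "c \<in> A" for c
    proof -
      have "(\<Oplus>\<^bsub>M\<^esub>a\<in>A. \<kappa> c (x a \<otimes>\<^bsub>R\<^esub> \<one>\<^bsub>R\<^esub>) \<odot>\<^bsub>M\<^esub> m a) = (\<Oplus>\<^bsub>M\<^esub>a\<in>A. if c = a then m a else \<zero>\<^bsub>M\<^esub>)"
        using c m' by (intro M.finsum_cong') (auto simp: coord_basis)
      also have "\<dots> = m c"
        using c m' finite_basis by (intro M.finsum_singleton) auto
      finally show ?thesis .
    qed
    then have one: "(\<one>\<^bsub>R\<^esub> \<odot>\<^bsub>base_change M\<^esub> m) c = m c" if "c \<in> A" for c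
      using that by simp
    show "\<one>\<^bsub>R\<^esub> \<odot>\<^bsub>base_change M\<^esub> m = m"
      by (rule extensionalityI[of _ A]) (use m one in \<open>auto simp: PiE_def\<close>)
    show "\<zero>\<^bsub>R\<^esub> \<odot>\<^bsub>base_change M\<^esub> m = \<zero>\<^bsub>base_change M\<^esub>"
      unfolding base_change_simps
    proof (rule restrict_ext)
      fix c assume "c \<in> A"
      then show "(\<Oplus>\<^bsub>M\<^esub>a\<in>A. \<kappa> c (x a \<otimes>\<^bsub>R\<^esub> \<zero>\<^bsub>R\<^esub>) \<odot>\<^bsub>M\<^esub> m a) = \<zero>\<^bsub>M\<^esub>"
        using m' by (intro M.add.finprod_one_eqI) simp
    qed
  next
    fix m assume "m \<in> carrier (base_change M)"
    then show "\<zero>\<^bsub>base_change M\<^esub> \<oplus>\<^bsub>base_change M\<^esub> m = m"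
      by (intro extensionalityI[of _ A]) (auto simp: PiE_iff)
  qed (auto simp: R.is_cring PiE_iff M.a_ac intro!: restrict_ext)
qed

text \<open>The map induced by \<open>h\<close> on tensor products, in coordinates. It is restricted
  to \<open>A\<close> so that values stay in the extensional function space.\<close>

definition base_change_map :: "('a \<Rightarrow> 'b) \<Rightarrow> ('e \<Rightarrow> 'a) \<Rightarrow> 'e \<Rightarrow> 'b" where
  "base_change_map h m = (\<lambda>a\<in>A. h (m a))"

lemma mod_hom_base_change:
  assumes M: "Module.module S M" and N: "Module.module S N" and h: "h \<in> mod_hom S M N"
  shows "base_change_map h \<in> mod_hom R (base_change M) (base_change N)"
proof (rule mod_homI)
  interpret M: Module.module S M by fact
  fix f m assume f: "f \<in> carrier R" and m: "m \<in> carrier (base_change M)"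
  then have m': "m a \<in> carrier M" if "a \<in> A" for a
    using that by (auto simp: PiE_iff)
  have "h (\<Oplus>\<^bsub>M\<^esub>a\<in>A. \<kappa> c (x a \<otimes>\<^bsub>R\<^esub> f) \<odot>\<^bsub>M\<^esub> m a) =
      (\<Oplus>\<^bsub>N\<^esub>a\<in>A. \<kappa> c (x a \<otimes>\<^bsub>R\<^esub> f) \<odot>\<^bsub>N\<^esub> (\<lambda>a\<in>A. h (m a)) a)" if "c \<in> A" for c
  proof -
    interpret N: Module.module S N by fact
    have "h (\<Oplus>\<^bsub>M\<^esub>a\<in>A. \<kappa> c (x a \<otimes>\<^bsub>R\<^esub> f) \<odot>\<^bsub>M\<^esub> m a) =
        (\<Oplus>\<^bsub>N\<^esub>a\<in>A. h (\<kappa> c (x a \<otimes>\<^bsub>R\<^esub> f) \<odot>\<^bsub>M\<^esub> m a))"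
      using f m' that by (intro mod_hom_finsum[OF M N h]) auto
    also have "\<dots> = (\<Oplus>\<^bsub>N\<^esub>a\<in>A. \<kappa> c (x a \<otimes>\<^bsub>R\<^esub> f) \<odot>\<^bsub>N\<^esub> (\<lambda>a\<in>A. h (m a)) a)"
      using f m' that mod_hom_closed[OF h]
      by (intro N.finsum_cong') (auto simp: mod_hom_smult[OF h])
    finally show ?thesis .
  qed
  then show "base_change_map h (f \<odot>\<^bsub>base_change M\<^esub> m) = f \<odot>\<^bsub>base_change N\<^esub> base_change_map h m"
    by (auto simp: base_change_map_def intro!: restrict_ext)
qed (use mod_hom_closed[OF h] mod_hom_add[OF h] in
    \<open>auto simp: base_change_map_def PiE_iff intro!: restrict_ext\<close>)

lemma base_change_map_image: "base_change_map h ` (A \<rightarrow>\<^sub>E X) = A \<rightarrow>\<^sub>E h ` X"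
proof (intro equalityI subsetI)
  fix m assume m: "m \<in> A \<rightarrow>\<^sub>E h ` X"
  then have "\<forall>a\<in>A. \<exists>y\<in>X. h y = m a"
    by (auto dest!: PiE_mem)
  then obtain n where "\<forall>a\<in>A. n a \<in> X \<and> h (n a) = m a"
    by metis
  then have "restrict n A \<in> A \<rightarrow>\<^sub>E X" "base_change_map h (restrict n A) = m"
    using m by (auto simp: base_change_map_def fun_eq_iff PiE_def extensional_def)
  then show "m \<in> base_change_map h ` (A \<rightarrow>\<^sub>E X)"
    by blast
qed (auto simp: base_change_map_def)

text \<open>Kernels, like images in the lemma before, are formed coordinatewise. Together these give
  the exactness of base change.\<close>

lemma base_change_map_kernel:
  "a_kernel (base_change M) (base_change N) (base_change_map h) = A \<rightarrow>\<^sub>E a_kernel M N h"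
  by (auto simp: a_kernel_eq base_change_map_def fun_eq_iff PiE_def Pi_iff)

lemma retract_of_base_change:
  assumes "Module.module S M" "Module.module S N" "retract_of S M N"
  shows "retract_of R (base_change M) (base_change N)"
proof -
  obtain i p where i: "i \<in> mod_hom S M N" and p: "p \<in> mod_hom S N M"
    and pi: "\<forall>x\<in>carrier M. p (i x) = x"
    using assms(3) by (auto simp: retract_of_def)
  show ?thesis
    by (rule retract_ofI[OF mod_hom_base_change[OF assms(1,2) i] mod_hom_base_change[OF assms(2,1) p]])
      (use pi in \<open>auto simp: base_change_map_def fun_eq_iff PiE_def extensional_def\<close>)
qed

text \<open>Taking coordinates of every entry is the isomorphism; its linearity is
  \<open>coord_mult\<close>, read entry by entry.\<close>

lemma base_change_free_module:
  "retract_of R (base_change (free_module S :: ('s, 't \<Rightarrow> 's) module)) (free_module R :: ('r, 't \<Rightarrow> 'r) module)"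
proof (rule retract_of_if_bij(2))
  let ?F = "free_module R :: ('r, 't \<Rightarrow> 'r) module"
  let ?G = "free_module S :: ('s, 't \<Rightarrow> 's) module"
  let ?h = "\<lambda>f. \<lambda>a\<in>A. \<lambda>t. \<kappa> a (f t)"
  show "Module.module R ?F"
    by (rule module_free_module) (rule R.is_cring)
  interpret G: Module.module S ?G
    by (rule module_free_module) (rule S.is_cring)
  have closed: "?h f \<in> carrier (base_change ?G)" if "f \<in> carrier ?F" for f
  proof -
    have "finite {t. \<kappa> a (f t) \<noteq> \<zero>\<^bsub>S\<^esub>}" if "a \<in> A" for a
      by (rule finite_subset[of _ "{t. f t \<noteq> \<zero>\<^bsub>R\<^esub>}"]) (use \<open>f \<in> carrier ?F\<close> that in auto)
    with that show ?thesis
      by auto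
  qed
  show "?h \<in> mod_hom R ?F (base_change ?G)"
  proof (rule mod_homI)
    fix r and f :: "'t \<Rightarrow> 'r"
    assume r: "r \<in> carrier R" and f: "f \<in> carrier ?F"
    have "(\<lambda>t. \<kappa> c (r \<otimes>\<^bsub>R\<^esub> f t)) = (\<Oplus>\<^bsub>?G\<^esub>a\<in>A. \<kappa> c (x a \<otimes>\<^bsub>R\<^esub> r) \<odot>\<^bsub>?G\<^esub> ?h f a)" if c: "c \<in> A" for c
    proof
      fix t
      have "(\<lambda>a. \<kappa> c (x a \<otimes>\<^bsub>R\<^esub> r) \<odot>\<^bsub>?G\<^esub> ?h f a) \<in> A \<rightarrow> carrier ?G"
        using r c PiE_mem[OF closed[OF f, unfolded base_change_simps]]
        by (intro Pi_I G.smult_closed) (simp_all del: free_module_simps)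
      then have "(\<Oplus>\<^bsub>?G\<^esub>a\<in>A. \<kappa> c (x a \<otimes>\<^bsub>R\<^esub> r) \<odot>\<^bsub>?G\<^esub> ?h f a) t =
          (\<Oplus>\<^bsub>S\<^esub>a\<in>A. (\<kappa> c (x a \<otimes>\<^bsub>R\<^esub> r) \<odot>\<^bsub>?G\<^esub> ?h f a) t)"
        by (rule eval_free_module_finsum[OF S.is_cring])
      also have "\<dots> = (\<Oplus>\<^bsub>S\<^esub>a\<in>A. \<kappa> c (x a \<otimes>\<^bsub>R\<^esub> r) \<otimes>\<^bsub>S\<^esub> \<kappa> a (f t))"
        using r f c by (intro S.finsum_cong') auto
      also have "\<dots> = \<kappa> c (r \<otimes>\<^bsub>R\<^esub> f t)"
        using r f c by (simp add: coord_mult)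
      finally show "\<kappa> c (r \<otimes>\<^bsub>R\<^esub> f t) = (\<Oplus>\<^bsub>?G\<^esub>a\<in>A. \<kappa> c (x a \<otimes>\<^bsub>R\<^esub> r) \<odot>\<^bsub>?G\<^esub> ?h f a) t" ..
    qed
    then show "?h (r \<odot>\<^bsub>?F\<^esub> f) = r \<odot>\<^bsub>base_change ?G\<^esub> ?h f"
      unfolding base_change_simps by (intro restrict_ext) simp
  next
    fix f assume "f \<in> carrier ?F"
    then show "?h f \<in> carrier (base_change ?G)"
      by (rule closed)
  qed (auto simp: coord_add intro!: restrict_ext)
  show "bij_betw ?h (carrier ?F) (carrier (base_change ?G))"
    unfolding bij_betw_def
  proof (intro conjI equalityI subsetI inj_onI)
    fix f g assume f: "f \<in> carrier ?F" and g: "g \<in> carrier ?F" and eq: "?h f = ?h g"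
    have "\<kappa> a (f t) = \<kappa> a (g t)" if "a \<in> A" for a t
      using fun_cong[OF fun_cong[OF eq], of a t] that by simp
    then have "(\<Oplus>\<^bsub>R\<^esub>a\<in>A. x a \<otimes>\<^bsub>R\<^esub> \<phi> (\<kappa> a (f t))) = (\<Oplus>\<^bsub>R\<^esub>a\<in>A. x a \<otimes>\<^bsub>R\<^esub> \<phi> (\<kappa> a (g t)))" for t
      using g by (intro R.finsum_cong') auto
    with f g show "f = g"
      by (simp add: expand fun_eq_iff)
  next
    fix m assume m: "m \<in> carrier (base_change ?G)"
    let ?f = "\<lambda>t. \<Oplus>\<^bsub>R\<^esub>a\<in>A. x a \<otimes>\<^bsub>R\<^esub> \<phi> (m a t)"
    have m': "m a t \<in> carrier S" "finite {t. m a t \<noteq> \<zero>\<^bsub>S\<^esub>}" if "a \<in> A" for a t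
      using PiE_mem[OF m[unfolded base_change_simps] that] by auto
    have "{t. ?f t \<noteq> \<zero>\<^bsub>R\<^esub>} \<subseteq> (\<Union>a\<in>A. {t. m a t \<noteq> \<zero>\<^bsub>S\<^esub>})"
    proof
      fix t assume t: "t \<in> {t. ?f t \<noteq> \<zero>\<^bsub>R\<^esub>}"
      have "?f t = \<zero>\<^bsub>R\<^esub>" if "\<forall>a\<in>A. m a t = \<zero>\<^bsub>S\<^esub>"
        using that by (intro R.add.finprod_one_eqI) auto
      with t show "t \<in> (\<Union>a\<in>A. {t. m a t \<noteq> \<zero>\<^bsub>S\<^esub>})"
        by auto
    qed
    moreover have "finite (\<Union>a\<in>A. {t. m a t \<noteq> \<zero>\<^bsub>S\<^esub>})"
      using m' finite_basis by auto
    ultimately have "finite {t. ?f t \<noteq> \<zero>\<^bsub>R\<^esub>}"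
      by (rule finite_subset)
    then have f: "?f \<in> carrier ?F"
      using m' by auto
    have "m = ?h ?f"
    proof
      fix a
      have "m a = undefined" if "a \<notin> A"
        using m that by (auto simp: PiE_def extensional_def)
      then show "m a = ?h ?f a"
        using m' by (auto simp: coord_expansion)
    qed
    then show "m \<in> ?h ` carrier ?F"
      using f by (rule image_eqI)
  next
    fix m assume "m \<in> ?h ` carrier ?F"
    then show "m \<in> carrier (base_change ?G)"
      using closed by (elim imageE) (simp only:)
  qed
qed

lemma projective_module_base_change:
  assumes "projective_module S P"
  shows "projective_module R (base_change P)"
  using projective_module_if_retract_of_free_module[OF
      module_base_change[OF projective_module_module[OF assms]]
      retract_of_trans[OF retract_of_base_change[OF projective_module_module[OF assms]
          module_free_module[OF S.is_cring] retract_of_free_module_if_projective_module[OF assms]]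
        base_change_free_module]] .

text \<open>The terms now have carriers in \<open>'e \<Rightarrow> 'b\<close>; the passage back to
  the prescribed list type is left to the retract comparison.\<close>

lemma finite_resolution_base_change:
  fixes M :: "('s, 'a) module"
  assumes "Module.module S M" "finite_resolution TYPE('b) S l M"
  shows "finite_resolution TYPE('e \<Rightarrow> 'b) R l (base_change M)"
proof -
  obtain P :: "nat \<Rightarrow> ('s, 'b) module" and d e
    where res: "projective_resolution S M P d e" and zero: "\<forall>i>l. carrier (P i) = {\<zero>\<^bsub>P i\<^esub>}"
    using assms by (auto simp: finite_resolution_def)
  have P: "Module.module S (P i)" for i
    using res by (auto simp: projective_resolution_def projective_module_def)
  have "projective_resolution R (base_change M) (\<lambda>i. base_change (P i))
      (\<lambda>i. base_change_map (d i)) (base_change_map e)"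
    using res unfolding projective_resolution_def base_change_map_kernel base_change_simps
      base_change_map_image
    by (simp add: projective_module_base_change mod_hom_base_change P assms(1))
  moreover have "\<forall>i>l. carrier (base_change (P i)) = {\<zero>\<^bsub>base_change (P i)\<^esub>}"
    using zero by (auto simp: PiE_eq_singleton)
  ultimately show ?thesis
    unfolding finite_resolution_def by (intro exI conjI)
qed


subsection \<open>Extended ideals\<close>

lemma coord_extended_ideal:
  assumes I: "ideal I S" and "f \<in> Idl\<^bsub>R\<^esub> (\<phi> ` I)" "a \<in> A"
  shows "\<kappa> a f \<in> I"
proof -
  interpret I: ideal I S by fact
  let ?J = "{f \<in> carrier R. \<forall>a\<in>A. \<kappa> a f \<in> I}"
  have finsum_I: "finsum S s B \<in> I" if "s \<in> B \<rightarrow> I" for s and B :: "'e set"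
    using that
  proof (induction B rule: infinite_finite_induct)
    case (insert b B)
    then have "s \<in> B \<rightarrow> I" "s b \<in> I"
      by auto
    with insert show ?case
      using I.a_subset by (subst S.finsum_insert) (auto simp: Pi_iff)
  qed (simp_all add: S.finsum_infinite)
  have mult: "f \<otimes>\<^bsub>R\<^esub> g \<in> ?J" if "f \<in> carrier R" "g \<in> ?J" for f g
  proof -
    have "\<kappa> a (f \<otimes>\<^bsub>R\<^esub> g) \<in> I" if a: "a \<in> A" for a
    proof -
      have "(\<Oplus>\<^bsub>S\<^esub>b\<in>A. \<kappa> a (x b \<otimes>\<^bsub>R\<^esub> f) \<otimes>\<^bsub>S\<^esub> \<kappa> b g) \<in> I"
        using \<open>f \<in> carrier R\<close> \<open>g \<in> ?J\<close> a by (intro finsum_I Pi_I I.I_l_closed) auto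
      then show ?thesis
        using coord_mult[OF a] that \<open>f \<in> carrier R\<close> \<open>g \<in> ?J\<close> by simp
    qed
    with that show ?thesis
      by simp
  qed
  have "ideal ?J R"
  proof (rule idealI)
    show "subgroup ?J (add_monoid R)"
    proof (rule R.add.subgroupI)
      show "\<ominus>\<^bsub>R\<^esub> f \<in> ?J" if "f \<in> ?J" for f
        using mult[of "\<ominus>\<^bsub>R\<^esub> \<one>\<^bsub>R\<^esub>" f] that by (auto simp: R.l_minus)
    qed (auto simp: coord_add)
    show "f \<otimes>\<^bsub>R\<^esub> g \<in> ?J" if "g \<in> ?J" "f \<in> carrier R" for f g
      using that by (intro mult)
    then show "g \<otimes>\<^bsub>R\<^esub> f \<in> ?J" if "g \<in> ?J" "f \<in> carrier R" for f g
      using that by (subst R.m_comm) auto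
  qed (rule R.ring_axioms)
  moreover have "\<phi> ` I \<subseteq> ?J"
  proof safe
    fix s a assume s: "s \<in> I" and a: "a \<in> A"
    then have "\<kappa> a (\<phi> s \<otimes>\<^bsub>R\<^esub> \<one>\<^bsub>R\<^esub>) = s \<otimes>\<^bsub>S\<^esub> \<kappa> a \<one>\<^bsub>R\<^esub>"
      using I.a_subset by (intro coord_smult) auto
    with s a show "\<kappa> a (\<phi> s) \<in> I"
      using I.a_subset I.I_r_closed[of s "\<kappa> a \<one>\<^bsub>R\<^esub>"] by auto
  qed (use I.a_subset in auto)
  ultimately have "Idl\<^bsub>R\<^esub> (\<phi> ` I) \<subseteq> ?J"
    by (rule R.genideal_minimal)
  with assms show ?thesis
    by auto
qed

lemma extended_ideal:
  assumes "ideal I S"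
  shows "ideal (Idl\<^bsub>R\<^esub> (\<phi> ` I)) R" and "\<phi> ` I \<subseteq> Idl\<^bsub>R\<^esub> (\<phi> ` I)"
proof -
  interpret I: ideal I S by fact
  have "\<phi> ` I \<subseteq> carrier R"
    using I.a_subset by auto
  then show "ideal (Idl\<^bsub>R\<^esub> (\<phi> ` I)) R" "\<phi> ` I \<subseteq> Idl\<^bsub>R\<^esub> (\<phi> ` I)"
    by (auto intro: R.genideal_ideal R.genideal_self[THEN subsetD])
qed

text \<open>\<open>\<phi>\<close> induces the injection and \<open>\<kappa> a\<^sub>0\<close> the
  projection; the latter respects cosets by \<open>coord_extended_ideal\<close>. They compose to the
  identity because \<open>x a\<^sub>0\<close> is 1.\<close>

lemma quot_module_retract_of_restrict_scalars:
  assumes I: "ideal I S"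
  shows "retract_of S (quot_module S I) (restrict_scalars (quot_module R (Idl\<^bsub>R\<^esub> (\<phi> ` I))))"
proof -
  let ?J = "Idl\<^bsub>R\<^esub> (\<phi> ` I)"
  note J = extended_ideal[OF I]
  let ?M = "quot_module S I" and ?N = "restrict_scalars (quot_module R ?J)"
  have M: "Module.module S ?M"
    using S.is_cring I by (rule module_quot_module)
  have N: "Module.module S ?N"
    by (rule module_restrict_scalars[OF module_quot_module[OF R.is_cring J(1)]])
  interpret I: ideal I S by fact
  interpret J: ideal ?J R by fact
  have "\<exists>i. \<forall>s\<in>carrier S. i (I +>\<^bsub>S\<^esub> s) = ?J +>\<^bsub>R\<^esub> \<phi> s"
  proof (rule quot_lift[OF S.is_cring I N])
    fix s assume s: "s \<in> I"
    then have "s \<in> carrier S" "\<phi> s \<in> ?J"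
      using J(2) I.a_subset by auto
    then show "?J +>\<^bsub>R\<^esub> \<phi> s = \<zero>\<^bsub>?N\<^esub>"
      by (simp add: quot_module_zero[OF J(1)] a_r_coset_eq_iff[OF J(1)] R.minus_eq)
  qed (auto simp: quot_module_carrier quot_module_add[OF J(1)] ring_hom_add[OF hom])
  then obtain i where i: "\<forall>s\<in>carrier S. i (I +>\<^bsub>S\<^esub> s) = ?J +>\<^bsub>R\<^esub> \<phi> s" ..
  have "\<exists>p. \<forall>f\<in>carrier R. p (?J +>\<^bsub>R\<^esub> f) = I +>\<^bsub>S\<^esub> \<kappa> a\<^sub>0 f"
  proof (rule quot_lift[OF R.is_cring J(1) M])
    fix f assume f: "f \<in> ?J"
    then have "f \<in> carrier R" "\<kappa> a\<^sub>0 f \<in> I"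
      using J.a_subset coord_extended_ideal[OF I f one_index] by auto
    then show "I +>\<^bsub>S\<^esub> \<kappa> a\<^sub>0 f = \<zero>\<^bsub>?M\<^esub>"
      by (simp add: quot_module_zero[OF I] a_r_coset_eq_iff[OF I] S.minus_eq one_index)
  qed (auto simp: quot_module_carrier quot_module_add[OF I] coord_add one_index)
  then obtain p where p: "\<forall>f\<in>carrier R. p (?J +>\<^bsub>R\<^esub> f) = I +>\<^bsub>S\<^esub> \<kappa> a\<^sub>0 f" ..
  show ?thesis
  proof (rule retract_ofI)
    show "i \<in> mod_hom S ?M ?N"
      by (rule mod_homI)
        (auto simp: quot_module_carrier quot_module_add[OF I] quot_module_add[OF J(1)]
          quot_module_smult[OF I] quot_module_smult[OF J(1)] i ring_hom_add[OF hom]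
          ring_hom_mult[OF hom])
    show "p \<in> mod_hom S ?N ?M"
      by (rule mod_homI)
        (auto simp: quot_module_carrier quot_module_add[OF I] quot_module_add[OF J(1)]
          quot_module_smult[OF I] quot_module_smult[OF J(1)] p coord_add coord_smult one_index)
    have "\<kappa> a\<^sub>0 (\<phi> s) = s" if "s \<in> carrier S" for s
      using coord_smult[OF one_index that R.one_closed] that coord_basis[of a\<^sub>0 a\<^sub>0]
      by (simp add: one_index basis_one)
    then show "p (i C) = C" if "C \<in> carrier ?M" for C
      using that by (auto simp: quot_module_carrier i p)
  qed
qed

text \<open>This is the isomorphism of \<open>R/IR\<close> with the tensor product of
  \<open>R\<close> and \<open>S/I\<close>, sending a class to the classes of its
  coordinates.\<close>

lemma quot_module_retract_of_base_change:
  assumes I: "ideal I S"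
  shows "retract_of R (quot_module R (Idl\<^bsub>R\<^esub> (\<phi> ` I))) (base_change (quot_module S I))"
proof -
  let ?J = "Idl\<^bsub>R\<^esub> (\<phi> ` I)"
  note J = extended_ideal[OF I]
  let ?M = "base_change (quot_module S I)" and ?N = "quot_module R ?J"
  have M: "Module.module R ?M"
    by (rule module_base_change[OF module_quot_module[OF S.is_cring I]])
  have N: "Module.module R ?N"
    using R.is_cring J(1) by (rule module_quot_module)
  interpret I: ideal I S by fact
  interpret J: ideal ?J R by fact
  interpret N: Module.module R ?N by fact
  interpret Q: Module.module S "quot_module S I"
    by (rule module_quot_module[OF S.is_cring I])
  have "\<exists>h. \<forall>f\<in>carrier R. h (?J +>\<^bsub>R\<^esub> f) = (\<lambda>a\<in>A. I +>\<^bsub>S\<^esub> \<kappa> a f)"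
  proof (rule quot_lift[OF R.is_cring J(1) M])
    fix f assume f: "f \<in> ?J"
    then have f': "f \<in> carrier R"
      using J.a_subset by auto
    have "I +>\<^bsub>S\<^esub> \<kappa> a f = \<zero>\<^bsub>quot_module S I\<^esub>" if "a \<in> A" for a
      using f' that coord_extended_ideal[OF I f that]
      by (simp add: quot_module_zero[OF I] a_r_coset_eq_iff[OF I] S.minus_eq)
    then show "(\<lambda>a\<in>A. I +>\<^bsub>S\<^esub> \<kappa> a f) = \<zero>\<^bsub>?M\<^esub>"
      unfolding base_change_simps by (intro restrict_ext)
  qed (auto simp: quot_module_carrier quot_module_add[OF I] coord_add intro!: restrict_ext)
  then obtain h where h: "\<forall>f\<in>carrier R. h (?J +>\<^bsub>R\<^esub> f) = (\<lambda>a\<in>A. I +>\<^bsub>S\<^esub> \<kappa> a f)" ..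
  have h_hom: "h \<in> mod_hom R ?N ?M"
  proof (rule mod_homI)
    fix f C assume f: "f \<in> carrier R" and "C \<in> carrier ?N"
    then obtain g where g: "g \<in> carrier R" "C = ?J +>\<^bsub>R\<^esub> g"
      by (auto simp: quot_module_carrier)
    have "I +>\<^bsub>S\<^esub> \<kappa> c (f \<otimes>\<^bsub>R\<^esub> g) =
        (\<Oplus>\<^bsub>quot_module S I\<^esub>a\<in>A. \<kappa> c (x a \<otimes>\<^bsub>R\<^esub> f) \<odot>\<^bsub>quot_module S I\<^esub> (\<lambda>a\<in>A. I +>\<^bsub>S\<^esub> \<kappa> a g) a)"
      if c: "c \<in> A" for c
    proof -
      have "I +>\<^bsub>S\<^esub> \<kappa> c (f \<otimes>\<^bsub>R\<^esub> g) = I +>\<^bsub>S\<^esub> (\<Oplus>\<^bsub>S\<^esub>a\<in>A. \<kappa> c (x a \<otimes>\<^bsub>R\<^esub> f) \<otimes>\<^bsub>S\<^esub> \<kappa> a g)"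
        using f g c by (simp add: coord_mult)
      also have "\<dots> = (\<Oplus>\<^bsub>quot_module S I\<^esub>a\<in>A. I +>\<^bsub>S\<^esub> (\<kappa> c (x a \<otimes>\<^bsub>R\<^esub> f) \<otimes>\<^bsub>S\<^esub> \<kappa> a g))"
        using f g c by (intro quot_module_finsum[OF S.is_cring I, symmetric]) auto
      also have "\<dots> =
          (\<Oplus>\<^bsub>quot_module S I\<^esub>a\<in>A. \<kappa> c (x a \<otimes>\<^bsub>R\<^esub> f) \<odot>\<^bsub>quot_module S I\<^esub> (\<lambda>a\<in>A. I +>\<^bsub>S\<^esub> \<kappa> a g) a)"
        using f g c
        by (intro Q.finsum_cong') (auto simp: quot_module_smult[OF I] quot_module_carrier)
      finally show ?thesis .
    qed
    with f g show "h (f \<odot>\<^bsub>?N\<^esub> C) = f \<odot>\<^bsub>?M\<^esub> h C"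
      by (auto simp: quot_module_smult[OF J(1)] h intro!: restrict_ext)
  qed (auto simp: quot_module_carrier quot_module_add[OF J(1)] quot_module_add[OF I] h coord_add
      intro!: restrict_ext)
  have "bij_betw h (carrier ?N) (carrier ?M)"
    unfolding bij_betw_def
  proof (intro conjI inj_onI)
    fix C D assume "C \<in> carrier ?N" "D \<in> carrier ?N" "h C = h D"
    then obtain f g where f: "f \<in> carrier R" "C = ?J +>\<^bsub>R\<^esub> f" and g: "g \<in> carrier R" "D = ?J +>\<^bsub>R\<^esub> g"
      and eq: "(\<lambda>a\<in>A. I +>\<^bsub>S\<^esub> \<kappa> a f) = (\<lambda>a\<in>A. I +>\<^bsub>S\<^esub> \<kappa> a g)"
      by (auto simp: quot_module_carrier h)
    \<comment> \<open>For injectivity: a difference of coordinates lies in \<open>I\<close>, so its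
      image under \<open>\<phi>\<close> times \<open>x a\<close> lies in \<open>?J\<close>. Summing
      over the basis recovers \<open>f\<close> and \<open>g\<close>.\<close>
    have J_eq: "?J +>\<^bsub>R\<^esub> (x a \<otimes>\<^bsub>R\<^esub> \<phi> (\<kappa> a f)) = ?J +>\<^bsub>R\<^esub> (x a \<otimes>\<^bsub>R\<^esub> \<phi> (\<kappa> a g))" if a: "a \<in> A" for a
    proof -
      have "\<kappa> a f \<ominus>\<^bsub>S\<^esub> \<kappa> a g \<in> I"
        using fun_cong[OF eq, of a] f g a by (simp add: a_r_coset_eq_iff[OF I])
      then have "x a \<otimes>\<^bsub>R\<^esub> \<phi> (\<kappa> a f \<ominus>\<^bsub>S\<^esub> \<kappa> a g) \<in> ?J"
        using a J(2) by (intro J.I_l_closed) auto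
      moreover have "\<phi> (\<kappa> a f \<ominus>\<^bsub>S\<^esub> \<kappa> a g) = \<phi> (\<kappa> a f) \<ominus>\<^bsub>R\<^esub> \<phi> (\<kappa> a g)"
      proof -
        have "\<phi> (\<kappa> a f \<ominus>\<^bsub>S\<^esub> \<kappa> a g) \<oplus>\<^bsub>R\<^esub> \<phi> (\<kappa> a g) = \<phi> (\<kappa> a f \<ominus>\<^bsub>S\<^esub> \<kappa> a g \<oplus>\<^bsub>S\<^esub> \<kappa> a g)"
          using a f g by (simp add: ring_hom_add[OF hom])
        also have "\<kappa> a f \<ominus>\<^bsub>S\<^esub> \<kappa> a g \<oplus>\<^bsub>S\<^esub> \<kappa> a g = \<kappa> a f"
          using a f g by (simp add: a_minus_def S.a_assoc S.l_neg)
        finally have *: "\<phi> (\<kappa> a f \<ominus>\<^bsub>S\<^esub> \<kappa> a g) \<oplus>\<^bsub>R\<^esub> \<phi> (\<kappa> a g) = \<phi> (\<kappa> a f)" .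
        show ?thesis
          unfolding *[symmetric] using a f g by (simp add: a_minus_def R.a_assoc R.r_neg)
      qed
      ultimately show ?thesis
        using a f g by (simp add: a_r_coset_eq_iff[OF J(1)] a_minus_def R.r_distr R.r_minus)
    qed
    have "?J +>\<^bsub>R\<^esub> (\<Oplus>\<^bsub>R\<^esub>a\<in>A. x a \<otimes>\<^bsub>R\<^esub> \<phi> (\<kappa> a f)) =
        (\<Oplus>\<^bsub>?N\<^esub>a\<in>A. ?J +>\<^bsub>R\<^esub> (x a \<otimes>\<^bsub>R\<^esub> \<phi> (\<kappa> a f)))"
      using f by (intro quot_module_finsum[OF R.is_cring J(1), symmetric]) auto
    also have "\<dots> = (\<Oplus>\<^bsub>?N\<^esub>a\<in>A. ?J +>\<^bsub>R\<^esub> (x a \<otimes>\<^bsub>R\<^esub> \<phi> (\<kappa> a g)))"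
      using g J_eq by (intro N.finsum_cong') (auto simp: quot_module_carrier)
    also have "\<dots> = ?J +>\<^bsub>R\<^esub> (\<Oplus>\<^bsub>R\<^esub>a\<in>A. x a \<otimes>\<^bsub>R\<^esub> \<phi> (\<kappa> a g))"
      using g by (intro quot_module_finsum[OF R.is_cring J(1)]) auto
    finally show "C = D"
      using f g by (simp add: expand)
  next
    have "m \<in> h ` carrier ?N" if m: "m \<in> carrier ?M" for m
    proof -
      from m have "\<forall>a\<in>A. \<exists>s\<in>carrier S. m a = I +>\<^bsub>S\<^esub> s"
        by (auto simp: quot_module_carrier dest: PiE_mem)
      then obtain s where s: "\<forall>a\<in>A. s a \<in> carrier S \<and> m a = I +>\<^bsub>S\<^esub> s a"
        by metis
      let ?f = "\<Oplus>\<^bsub>R\<^esub>a\<in>A. x a \<otimes>\<^bsub>R\<^esub> \<phi> (s a)"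
      have f: "?f \<in> carrier R"
        using s by (intro R.finsum_closed) auto
      have "h (?J +>\<^bsub>R\<^esub> ?f) = m"
        using s m by (auto simp: h f coord_expansion fun_eq_iff PiE_def extensional_def)
      moreover have "?J +>\<^bsub>R\<^esub> ?f \<in> carrier ?N"
        using f by (auto simp: quot_module_carrier)
      ultimately show ?thesis
        by blast
    qed
    then show "h ` carrier ?N = carrier ?M"
      using mod_hom_closed[OF h_hom] by auto
  qed
  with N h_hom show ?thesis
    by (rule retract_of_if_bij(1))
qed

theorem projective_dimension_extended_ideal:
  assumes I: "ideal I S" and "\<one>\<^bsub>S\<^esub> \<noteq> \<zero>\<^bsub>S\<^esub>" "\<one>\<^bsub>R\<^esub> \<noteq> \<zero>\<^bsub>R\<^esub>"
  shows "projective_dimension S (quot_module S I) =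
    projective_dimension R (quot_module R (Idl\<^bsub>R\<^esub> (\<phi> ` I)))"
proof (rule antisym)
  note M = module_quot_module[OF S.is_cring I]
  note N = module_quot_module[OF R.is_cring extended_ideal(1)[OF I]]
  show "projective_dimension S (quot_module S I) \<le>
      projective_dimension R (quot_module R (Idl\<^bsub>R\<^esub> (\<phi> ` I)))"
    by (rule projective_dimension_le_if_retract_of[OF assms(2) M module_restrict_scalars[OF N]
          quot_module_retract_of_restrict_scalars[OF I] finite_resolution_restrict_scalars])
  show "projective_dimension R (quot_module R (Idl\<^bsub>R\<^esub> (\<phi> ` I))) \<le>
      projective_dimension S (quot_module S I)"
    by (rule projective_dimension_le_if_retract_of[OF assms(3) N module_base_change[OF M]
          quot_module_retract_of_base_change[OF I] finite_resolution_base_change[OF M]])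
qed

end


section \<open>The power substitution on polynomial rings\<close>

lemma mpoly_ring_simps [simp]:
  "f \<in> carrier (mpoly_ring n) \<longleftrightarrow> (\<forall>t\<in>Poly_Mapping.keys f. Poly_Mapping.keys t \<subseteq> {1..n})"
  "f \<otimes>\<^bsub>mpoly_ring n\<^esub> g = f * g" "f \<oplus>\<^bsub>mpoly_ring n\<^esub> g = f + g"
  "\<one>\<^bsub>mpoly_ring n\<^esub> = 1" "\<zero>\<^bsub>mpoly_ring n\<^esub> = 0"
  by (simp_all add: mpoly_ring_def)

lemma finsum_mpoly_ring:
  assumes "f \<in> A \<rightarrow> carrier (mpoly_ring n)"
  shows "finsum (mpoly_ring n) f A = sum f A"
proof -
  interpret cring "mpoly_ring n" by (rule cring_mpoly_ring)
  show ?thesis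
    using assms
  proof (induction A rule: infinite_finite_induct)
    case (insert a A)
    then have "f \<in> A \<rightarrow> carrier (mpoly_ring n)" "f a \<in> carrier (mpoly_ring n)"
      by auto
    with insert show ?case
      by (subst finsum_insert) (auto simp del: mpoly_ring_simps(1))
  qed (simp_all add: finsum_infinite)
qed

lemma poly_mapping_eq_sum_single:
  fixes f :: "'a \<Rightarrow>\<^sub>0 'b::comm_monoid_add"
  shows "f = (\<Sum>t\<in>Poly_Mapping.keys f. Poly_Mapping.single t (Poly_Mapping.lookup f t))"
  by (rule poly_mapping_eqI)
    (auto simp: lookup_sum lookup_single when_def in_keys_iff sum.delta)

text \<open>Additive identities need checking on monomials only; \<open>T\<close> confines the
  exponents, for instance to the variables of the ring.\<close>

lemma poly_mapping_add_induct:
  fixes f :: "'a \<Rightarrow>\<^sub>0 'b::comm_monoid_add"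
  assumes "P 0" "\<And>t c. t \<in> T \<Longrightarrow> P (Poly_Mapping.single t c)"
    and "\<And>f g. P f \<Longrightarrow> P g \<Longrightarrow> P (f + g)" and "Poly_Mapping.keys f \<subseteq> T"
  shows "P f"
proof -
  have "P (\<Sum>t\<in>B. Poly_Mapping.single t (Poly_Mapping.lookup f t))" if "B \<subseteq> T" for B
    using that by (induction B rule: infinite_finite_induct) (auto intro: assms(1-3))
  with assms(4) show ?thesis
    by (subst poly_mapping_eq_sum_single)
qed

section \<open>The substitution as scaling of exponents\<close>

definition scale_exps :: "nat \<Rightarrow> (nat \<Rightarrow>\<^sub>0 nat) \<Rightarrow> nat \<Rightarrow>\<^sub>0 nat" where
  "scale_exps m = Poly_Mapping.map ((*) m)"

lemma lookup_scale_exps [simp]: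
  "Poly_Mapping.lookup (scale_exps m t) i = m * Poly_Mapping.lookup t i"
  by (simp add: scale_exps_def Poly_Mapping.map.rep_eq when_def)

lemma scale_exps_zero [simp]: "scale_exps m 0 = 0"
  and scale_exps_add: "scale_exps m (t + u) = scale_exps m t + scale_exps m u"
  by (simp_all add: poly_mapping_eq_iff fun_eq_iff lookup_add distrib_left)

lemma power_single:
  "Poly_Mapping.single (Poly_Mapping.single i j) (1 :: 'k::field) ^ k =
    Poly_Mapping.single (Poly_Mapping.single i (j * k)) 1"
  by (induction k) (simp_all add: mult_single single_add[symmetric])

lemma prod_single_one:
  "(\<Prod>i\<in>B. Poly_Mapping.single (g i) (1 :: 'k::field)) = Poly_Mapping.single (\<Sum>i\<in>B. g i) 1"
  by (induction B rule: infinite_finite_induct) (simp_all add: mult_single)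

abbreviation power_subst :: "nat \<Rightarrow> 'k::field mpoly \<Rightarrow> 'k mpoly" where
  "power_subst m \<equiv> mpoly_subst (\<lambda>i. mpoly_var i ^ m)"

lemma power_subst_eq:
  fixes f :: "'k::field mpoly"
  shows "power_subst m f =
    (\<Sum>t\<in>Poly_Mapping.keys f. Poly_Mapping.single (scale_exps m t) (Poly_Mapping.lookup f t))"
proof -
  have "(\<Sum>i\<in>Poly_Mapping.keys t. Poly_Mapping.single i (m * Poly_Mapping.lookup t i)) =
      scale_exps m t" for t
    by (rule poly_mapping_eqI)
      (auto simp: lookup_sum lookup_single when_def in_keys_iff sum.delta)
  then have "(\<Prod>i\<in>Poly_Mapping.keys t. (mpoly_var i ^ m) ^ Poly_Mapping.lookup t i) =
      Poly_Mapping.single (scale_exps m t) (1 :: 'k)" for t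
    by (simp add: mpoly_var_def power_single prod_single_one)
  then show ?thesis
    by (simp add: mpoly_subst_def mpoly_const_def mult_single)
qed

lemma power_subst_single [simp]:
  "power_subst m (Poly_Mapping.single t c) = Poly_Mapping.single (scale_exps m t) c"
  by (simp add: power_subst_eq)

lemma power_subst_zero [simp]: "power_subst m 0 = 0"
  by (simp add: power_subst_eq)

lemma power_subst_add: "power_subst m (f + g) = power_subst m f + power_subst m g"
proof -
  let ?B = "Poly_Mapping.keys f \<union> Poly_Mapping.keys g"
  let ?s = "\<lambda>f t. Poly_Mapping.single (scale_exps m t) (Poly_Mapping.lookup f t)"
  \<comment> \<open>The support of \<open>f + g\<close> may be smaller by cancellation, so all three
    sums are taken over the union of the supports.\<close>
  have *: "power_subst m h = (\<Sum>t\<in>?B. ?s h t)" if "Poly_Mapping.keys h \<subseteq> ?B" for h :: "'a mpoly"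
    unfolding power_subst_eq using that
    by (intro sum.mono_neutral_left) (auto simp: in_keys_iff)
  show ?thesis
    using Poly_Mapping.keys_add[of f g]
    by (simp add: * lookup_add single_add sum.distrib)
qed

lemma power_subst_mult: "power_subst m (f * g) = power_subst m f * power_subst m g"
proof (rule poly_mapping_add_induct[of _ UNIV f])
  fix t and c :: 'a
  show "power_subst m (Poly_Mapping.single t c * g) =
      power_subst m (Poly_Mapping.single t c) * power_subst m g"
    by (rule poly_mapping_add_induct[of _ UNIV g])
      (simp_all add: mult_single scale_exps_add distrib_left power_subst_add)
qed (simp_all add: distrib_right power_subst_add)

lemma keys_power_subst: "Poly_Mapping.keys (power_subst m f) \<subseteq> scale_exps m ` Poly_Mapping.keys f"
  unfolding power_subst_eq by (rule order.trans[OF keys_sum]) auto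

lemma power_subst_closed:
  assumes "f \<in> carrier (mpoly_ring n)"
  shows "power_subst m f \<in> carrier (mpoly_ring n)"
proof -
  have "Poly_Mapping.keys (scale_exps m t) \<subseteq> Poly_Mapping.keys t" for t
    by (auto simp: in_keys_iff)
  then show ?thesis
    using assms keys_power_subst[of m f] by fastforce
qed

section \<open>Residue classes of exponents modulo \<open>m\<close>\<close>

definition residue_exps :: "nat \<Rightarrow> nat \<Rightarrow> (nat \<Rightarrow>\<^sub>0 nat) set" where
  "residue_exps n m = {a. Poly_Mapping.keys a \<subseteq> {1..n} \<and> (\<forall>i. Poly_Mapping.lookup a i < m)}"

text \<open>The coefficient of \<open>X\<^sup>a\<close> when \<open>f\<close> is expanded over the ring of polynomials in the \<open>X\<^sub>i\<^sup>m\<close>.\<close>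

definition residue_part :: "nat \<Rightarrow> (nat \<Rightarrow>\<^sub>0 nat) \<Rightarrow> 'k::field mpoly \<Rightarrow> 'k mpoly" where
  "residue_part m a = Poly_Mapping.map_key (\<lambda>t. a + scale_exps m t)"

text \<open>\<open>Poly_Mapping.map_key\<close> pulls coefficients back along a map of keys, and its
  laws require that map to be injective. For \<open>m = 0\<close> the map would be constant.\<close>

lemma inj_shift_scale_exps:
  assumes "m \<ge> 1"
  shows "inj (\<lambda>t. a + scale_exps m t)"
proof (rule injI)
  fix t u assume "a + scale_exps m t = a + scale_exps m u"
  then have "m * Poly_Mapping.lookup t i = m * Poly_Mapping.lookup u i" for i
    by (metis add_left_cancel lookup_scale_exps)
  with assms show "t = u"
    by (intro poly_mapping_eqI) simp
qed

lemma finite_residue_exps: "finite (residue_exps n m)"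
proof -
  have "Poly_Mapping.lookup ` residue_exps n m \<subseteq>
      {f. \<forall>i. (i \<in> {1..n} \<longrightarrow> f i \<in> {..<m}) \<and> (i \<notin> {1..n} \<longrightarrow> f i = 0)}"
    by (auto simp: residue_exps_def subset_iff in_keys_iff)
  moreover have "finite \<dots>"
    by (rule finite_set_of_finite_funs) auto
  ultimately have "finite (Poly_Mapping.lookup ` residue_exps n m)"
    by (rule finite_subset)
  then show ?thesis
    by (rule finite_imageD) (simp add: inj_on_def)
qed

lemma residue_exps_unique:
  assumes "a \<in> residue_exps n m" "u = a + scale_exps m v"
  shows "Poly_Mapping.lookup a i = Poly_Mapping.lookup u i mod m"
  using assms by (simp add: residue_exps_def lookup_add)

text \<open>Adding multiples of \<open>m\<close> keeps the residues, so \<open>u\<close> already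
  lies in the class of \<open>a\<close>, and its quotient by \<open>m\<close> is the witness. Hence
  a monomial outside that class stays outside after multiplication by an element of the
  image.\<close>

lemma residue_exps_shift_cancel:
  assumes "a \<in> residue_exps n m" "scale_exps m t + u = a + scale_exps m w"
  shows "\<exists>v. u = a + scale_exps m v"
proof
  let ?v = "Poly_Mapping.map (\<lambda>k. k div m) u"
  have v: "Poly_Mapping.lookup ?v i = Poly_Mapping.lookup u i div m" for i
    by (simp add: Poly_Mapping.map.rep_eq when_def)
  show "u = a + scale_exps m ?v"
  proof (rule poly_mapping_eqI)
    fix i
    have "Poly_Mapping.lookup a i = (m * Poly_Mapping.lookup t i + Poly_Mapping.lookup u i) mod m"
      using residue_exps_unique[OF assms, of i] by (simp add: lookup_add)
    then show "Poly_Mapping.lookup u i = Poly_Mapping.lookup (a + scale_exps m ?v) i"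
      by (simp add: lookup_add v)
  qed
qed

lemma residue_exps_expansion:
  assumes "m \<ge> 1" "Poly_Mapping.keys u \<subseteq> {1..n}"
  obtains a v where "a \<in> residue_exps n m" "u = a + scale_exps m v"
proof
  let ?a = "Poly_Mapping.map (\<lambda>k. k mod m) u" and ?v = "Poly_Mapping.map (\<lambda>k. k div m) u"
  have l: "Poly_Mapping.lookup ?v i = Poly_Mapping.lookup u i div m"
    "Poly_Mapping.lookup ?a i = Poly_Mapping.lookup u i mod m" for i
    by (simp_all add: Poly_Mapping.map.rep_eq when_def)
  have "Poly_Mapping.keys ?a \<subseteq> Poly_Mapping.keys u"
    by (auto simp: in_keys_iff l intro: ccontr)
  with assms show "?a \<in> residue_exps n m"
    by (auto simp: residue_exps_def l)
  show "u = ?a + scale_exps m ?v"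
    by (rule poly_mapping_eqI) (simp add: lookup_add l)
qed

lemma residue_part_zero [simp]: "m \<ge> 1 \<Longrightarrow> residue_part m a 0 = 0"
  unfolding residue_part_def by (rule map_key_zero[OF inj_shift_scale_exps])

lemma residue_part_single_shift:
  assumes "m \<ge> 1"
  shows "residue_part m a (Poly_Mapping.single (a + scale_exps m v) c) = Poly_Mapping.single v c"
  unfolding residue_part_def
  using map_key_single[OF inj_shift_scale_exps[OF assms], of a v c] .

lemma residue_part_single_other:
  assumes "m \<ge> 1" "\<nexists>v. u = a + scale_exps m v"
  shows "residue_part m a (Poly_Mapping.single u c) = 0"
  unfolding residue_part_def
  by (rule poly_mapping_eqI)
    (use assms(2) in \<open>auto simp: map_key.rep_eq[OF inj_shift_scale_exps[OF assms(1)]] lookup_single when_def\<close>)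

lemma residue_part_add:
  "m \<ge> 1 \<Longrightarrow> residue_part m a (f + g) = residue_part m a f + residue_part m a g"
  unfolding residue_part_def by (rule map_key_plus[OF inj_shift_scale_exps])

text \<open>Both sides are biadditive, so monomials suffice. Either the exponent of \<open>f\<close>
  lies in the class of \<open>a\<close> and the quotients add, or both sides vanish.\<close>

lemma residue_part_mult:
  assumes "m \<ge> 1" "a \<in> residue_exps n m"
  shows "residue_part m a (power_subst m s * f) = s * residue_part m a f"
proof (rule poly_mapping_add_induct[of _ UNIV s])
  fix t and c :: 'a
  show "residue_part m a (power_subst m (Poly_Mapping.single t c) * f) =
      Poly_Mapping.single t c * residue_part m a f"
  proof (rule poly_mapping_add_induct[of _ UNIV f])
    fix u :: "nat \<Rightarrow>\<^sub>0 nat" and d :: 'a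
    show "residue_part m a (power_subst m (Poly_Mapping.single t c) * Poly_Mapping.single u d) =
        Poly_Mapping.single t c * residue_part m a (Poly_Mapping.single u d)"
    proof (cases "\<exists>v. u = a + scale_exps m v")
      case True
      then obtain v where u: "u = a + scale_exps m v" ..
      have "scale_exps m t + u = a + scale_exps m (t + v)"
        by (simp add: u scale_exps_add ac_simps)
      then have "residue_part m a (Poly_Mapping.single (scale_exps m t + u) (c * d)) =
          Poly_Mapping.single (t + v) (c * d)"
        by (simp only: residue_part_single_shift[OF assms(1)])
      then show ?thesis
        by (simp add: mult_single u residue_part_single_shift[OF assms(1)])
    next
      case False
      then have "\<nexists>w. scale_exps m t + u = a + scale_exps m w"
        using residue_exps_shift_cancel[OF assms(2)] by blast
      with False show ?thesis
        by (simp add: mult_single residue_part_single_other[OF assms(1)])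
    qed
  qed (use assms(1) in \<open>simp_all add: distrib_left residue_part_add\<close>)
qed (use assms(1) in \<open>simp_all add: distrib_right residue_part_add power_subst_add\<close>)

lemma residue_part_closed:
  assumes "m \<ge> 1" "f \<in> carrier (mpoly_ring n)"
  shows "residue_part m a f \<in> carrier (mpoly_ring n)"
proof -
  \<comment> \<open>As \<open>m\<close> is positive, no variable of \<open>t\<close> is lost in
    \<open>a + scale_exps m t\<close>, so the variables of the part occur in
    \<open>f\<close>.\<close>
  have "Poly_Mapping.keys t \<subseteq> Poly_Mapping.keys (a + scale_exps m t)" for t
    using assms(1) by (auto simp: in_keys_iff lookup_add)
  then show ?thesis
    using assms(2)
    by (fastforce simp: residue_part_def keys_map_key[OF inj_shift_scale_exps[OF assms(1)]])
qed

lemma residue_expansion: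
  assumes "m \<ge> 1" "f \<in> carrier (mpoly_ring n)"
  shows "(\<Sum>a\<in>residue_exps n m. Poly_Mapping.single a 1 * power_subst m (residue_part m a f)) = f"
proof (rule poly_mapping_add_induct[of _ "{t. Poly_Mapping.keys t \<subseteq> {1..n}}" f])
  fix u :: "nat \<Rightarrow>\<^sub>0 nat" and d :: 'a
  assume "u \<in> {t. Poly_Mapping.keys t \<subseteq> {1..n}}"
  then obtain a v where a: "a \<in> residue_exps n m" and u: "u = a + scale_exps m v"
    using residue_exps_expansion[OF assms(1)] by blast
  \<comment> \<open>A monomial lies in exactly one residue class, so only the summand of that class
    survives.\<close>
  have "residue_part m b (Poly_Mapping.single u d) = 0" if "b \<in> residue_exps n m" "b \<noteq> a" for b
  proof (rule residue_part_single_other[OF assms(1)])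
    show "\<nexists>w. u = b + scale_exps m w"
      using that residue_exps_unique[OF a u] residue_exps_unique[OF that(1)]
      by (metis poly_mapping_eqI)
  qed
  then have "(\<Sum>b\<in>residue_exps n m. Poly_Mapping.single b 1 *
        power_subst m (residue_part m b (Poly_Mapping.single u d))) =
      (\<Sum>b\<in>{a}. Poly_Mapping.single b 1 *
        power_subst m (residue_part m b (Poly_Mapping.single u d)))"
    using a by (intro sum.mono_neutral_right finite_residue_exps) auto
  then show "(\<Sum>b\<in>residue_exps n m. Poly_Mapping.single b 1 *
      power_subst m (residue_part m b (Poly_Mapping.single u d))) = Poly_Mapping.single u d"
    by (simp add: u residue_part_single_shift[OF assms(1)] mult_single)
qed (use assms in \<open>auto simp: residue_part_add power_subst_add distrib_left sum.distrib\<close>)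

lemma residue_part_basis:
  assumes "m \<ge> 1" "a \<in> residue_exps n m" "b \<in> residue_exps n m"
  shows "residue_part m a (Poly_Mapping.single b 1) = (if a = b then 1 else 0)"
proof (cases "a = b")
  case True
  then show ?thesis
    using residue_part_single_shift[OF assms(1), of a 0 1] by simp
next
  case False
  have "\<nexists>v. b = a + scale_exps m v"
    \<comment> \<open>The instance with \<open>v = 0\<close> says that \<open>b\<close> is its own
      residue; if \<open>b\<close> were in the class of \<open>a\<close>, the two residues would
      agree.\<close>
    using False residue_exps_unique[OF assms(2)] residue_exps_unique[OF assms(3), of b 0]
    by (metis add_0_right poly_mapping_eqI scale_exps_zero)
  with False show ?thesis
    by (simp add: residue_part_single_other[OF assms(1)])
qed

text \<open>The polynomial ring plays both rings of the locale, and the index \<open>0\<close> is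
  the exponent of the power product 1.\<close>

lemma power_subst_finite_free_extension:
  assumes "m \<ge> 1"
  shows "finite_free_extension (mpoly_ring n) (mpoly_ring n :: 'k::field mpoly ring)
    (power_subst m) (residue_exps n m) (\<lambda>a. Poly_Mapping.single a 1) (residue_part m) 0"
proof -
  interpret cring "mpoly_ring n :: 'k mpoly ring"
    by (rule cring_mpoly_ring)
  have single: "Poly_Mapping.single a 1 \<in> carrier (mpoly_ring n)" if "a \<in> residue_exps n m" for a
    using that by (simp add: residue_exps_def)
  have expansion: "(\<Oplus>\<^bsub>mpoly_ring n\<^esub>a\<in>residue_exps n m.
      Poly_Mapping.single a 1 \<otimes>\<^bsub>mpoly_ring n\<^esub> power_subst m (residue_part m a f)) = f"
    if "f \<in> carrier (mpoly_ring n)" for f :: "'k mpoly"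
  proof -
    have "(\<lambda>a. Poly_Mapping.single a 1 \<otimes>\<^bsub>mpoly_ring n\<^esub> power_subst m (residue_part m a f))
        \<in> residue_exps n m \<rightarrow> carrier (mpoly_ring n)"
      using that assms
      by (intro Pi_I m_closed single power_subst_closed residue_part_closed)
    from finsum_mpoly_ring[OF this] show ?thesis
      using residue_expansion[OF assms that] by simp
  qed
  show ?thesis
  proof (unfold_locales)
    show "power_subst m \<in> ring_hom (mpoly_ring n) (mpoly_ring n)"
      using power_subst_closed
      \<comment> \<open>Preservation of 1 is checked by writing 1 as the monomial of exponent 0,
        which scaling fixes.\<close>
      by (intro ring_hom_memI)
        (simp_all add: power_subst_mult power_subst_add single_one[symmetric] del: single_one mpoly_ring_simps(1))
    show "0 \<in> residue_exps n m"
      using assms by (simp add: residue_exps_def)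
  qed (use assms single expansion in \<open>simp_all add: finite_residue_exps residue_part_closed
      residue_part_add residue_part_mult residue_part_basis del: mpoly_ring_simps(1)\<close>)
qed

theorem corollary2p8:
  fixes n m :: nat and I :: "'k::field mpoly set"
  assumes "homogeneous_ideal n I"
    and "m \<ge> 1"
  shows "projective_dimension (mpoly_ring n) (quot_module (mpoly_ring n) I) =
    projective_dimension (mpoly_ring n) (quot_module (mpoly_ring n) (square_power n m I))"
proof -
  interpret finite_free_extension "mpoly_ring n" "mpoly_ring n :: 'k mpoly ring" "power_subst m"
    "residue_exps n m" "\<lambda>a. Poly_Mapping.single a 1" "residue_part m" 0
    using assms(2) by (rule power_subst_finite_free_extension)
  show ?thesis
    \<comment> \<open>The unfolded ideal is literally the extension of \<open>I\<close> along the
      substitution.\<close>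
    unfolding square_power_def
    by (rule projective_dimension_extended_ideal)
      (use assms(1) in \<open>simp_all add: homogeneous_ideal_def\<close>)
qed

end
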